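(* Let $0\le\rho\le\tfrac12$. Consider all $(2,2)$ IR schemes $\mathscr C$ (two files, two servers) that satisfy, for some finite $\alpha\in\mathbb N$, $|\mathcal Q_l|\le\alpha$ and $|\mathcal A_l|\le|\mathcal X|^\beta$ for $l=1,2$, whose MI leakage satisfies $\rho^{(\mathsf{MI})}(\mathscr C)\le\rho$, and for which only one of the two servers can leak, i.e. $I(M;Q_l)=0$ for at least one $l\in\{1,2\}$. The maximum possible rate of such schemes is $$\mathsf R^{(\mathsf{MI})}_{\max}(\rho)=\bigl[1+H_b^{-1}(1-2\rho)\bigr]^{-1}.$$
   Context: Entropies in bits; $H_b$ is the binary entropy function and $H_b^{-1}:[0,1]\to[0,\tfrac12]$ its inverse on $[0,\tfrac12]$. An $(\mathsf M,n)$ IR scheme (here $\mathsf M=n=2$): $n$ noncolluding servers each store the same $\mathsf M$ independent files $X^{(1)},\dots,X^{(\mathsf M)}$, each uniform on $\mathcal X^\beta$ for a finite alphabet $\mathcal X$ with $|\mathcal X|\ge2$; the requested index $M$ is uniform on $\{1,\dots,\mathsf M\}$, independent of the files. The scheme $\mathscr C$ consists of: a random strategy $S$ independent of $M$ and the files; queries $Q_l=\phi_l(M,S)\in\mathcal Q_l$ sent to server $l$ (so the queries are independent of the files); answer-length functions $\ell_l:\mathcal Q_l\to\{0,1,\dots\}$; answers $A_l=\varphi_l(Q_l,X^{(1)},\dots,X^{(\mathsf M)})\in\mathcal A^{\ell_l(Q_l)}$; such that $H(X^{(M)}\mid A_1,\dots,A_n,Q_1,\dots,Q_n,M)=0$.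 $\mathcal A_l$ denotes the alphabet (set of values) of $A_l$; an answer of length $0$ is deterministic and is identified with a fixed element of $\mathcal A_l$. Rate: $\mathsf R(\mathscr C)=\beta\log_2|\mathcal X|/\mathsf D(\mathscr C)$ with $\mathsf D(\mathscr C)=\log_2|\mathcal A|\sum_{l=1}^n\mathbb E[\ell_l(Q_l)]$. MI leakage: $\rho^{(\mathsf{MI})}(\mathscr C)=\frac1n\sum_{l=1}^nI(M;Q_l)$. The file length $\beta$ and the alphabets $\mathcal X,\mathcal A$ are arbitrary (part of the scheme). *)

theory Defs
  imports "HOL-Probability.Probability"
begin

definition binary_entropy :: "real \<Rightarrow> real" where
  "binary_entropy p = - p * log 2 p - (1 - p) * log 2 (1 - p)"
  \<comment> \<open>\<open>log 2 0 = 0\<close> in HOL, so the convention \<open>0 log 0 = 0\<close> holds at both end points\<close>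

definition binary_entropy_inv :: "real \<Rightarrow> real" where
  "binary_entropy_inv = the_inv_into {0..1/2} binary_entropy"

text \<open>
  Servers, and likewise files, are numbered from 1. The first argument of \<open>query_fun\<close>,
  \<open>ans_len\<close> and \<open>ans_fun\<close> is the server; \<open>query_fun C l m s\<close> is $\phi_l(m, s)$ and
  \<open>ans_fun C l q x\<close> is $\varphi_l(q, x^{(1)}, \ldots, x^{(N)})$. The field \<open>strategy\<close> is the
  distribution of the random strategy, which need not be discrete.
\<close>

record ('s, 'x, 'a, 'q) ir_scheme =
  file_alphabet :: "'x set"
  file_len :: nat
  ans_alphabet :: "'a set"
  strategy :: "'s measure"
  query_set :: "nat \<Rightarrow> 'q set"
  query_fun :: "nat \<Rightarrow> nat \<Rightarrow> 's \<Rightarrow> 'q"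
  ans_len :: "nat \<Rightarrow> 'q \<Rightarrow> nat"
  ans_fun :: "nat \<Rightarrow> 'q \<Rightarrow> (nat \<Rightarrow> 'x list) \<Rightarrow> 'a list"

definition file_tuples :: "nat \<Rightarrow> ('s, 'x, 'a, 'q) ir_scheme \<Rightarrow> (nat \<Rightarrow> 'x list) set" where
  "file_tuples N C =
     {1..N} \<rightarrow>\<^sub>E {w. set w \<subseteq> file_alphabet C \<and> length w = file_len C}"

text \<open>
  The joint law of the requested index, the strategy and the files. It is a product measure, so
  these three are independent; the uniform law on the finite product \<open>file_tuples N C\<close> makes the
  files independent and uniform.
\<close>

definition ir_space ::
  "nat \<Rightarrow> ('s, 'x, 'a, 'q) ir_scheme \<Rightarrow> (nat \<times> 's \<times> (nat \<Rightarrow> 'x list)) measure" where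
  "ir_space N C =
     uniform_count_measure {1..N} \<Otimes>\<^sub>M strategy C \<Otimes>\<^sub>M uniform_count_measure (file_tuples N C)"

definition rv_index :: "nat \<times> 's \<times> (nat \<Rightarrow> 'x list) \<Rightarrow> nat" where
  "rv_index = (\<lambda>(m, s, x). m)"

definition rv_requested_file :: "nat \<times> 's \<times> (nat \<Rightarrow> 'x list) \<Rightarrow> 'x list" where
  "rv_requested_file = (\<lambda>(m, s, x). x m)"

definition rv_query ::
  "('s, 'x, 'a, 'q) ir_scheme \<Rightarrow> nat \<Rightarrow> nat \<times> 's \<times> (nat \<Rightarrow> 'x list) \<Rightarrow> 'q" where
  "rv_query C l = (\<lambda>(m, s, x). query_fun C l m s)"

definition rv_answer ::
  "('s, 'x, 'a, 'q) ir_scheme \<Rightarrow> nat \<Rightarrow> nat \<times> 's \<times> (nat \<Rightarrow> 'x list) \<Rightarrow> 'a list" where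
  "rv_answer C l = (\<lambda>(m, s, x). ans_fun C l (query_fun C l m s) x)"

definition rv_observation ::
  "nat \<Rightarrow> ('s, 'x, 'a, 'q) ir_scheme \<Rightarrow> nat \<times> 's \<times> (nat \<Rightarrow> 'x list) \<Rightarrow>
     (nat \<Rightarrow> 'a list) \<times> (nat \<Rightarrow> 'q) \<times> nat" where
  "rv_observation n C \<omega> =
     ((\<lambda>l\<in>{1..n}. rv_answer C l \<omega>), (\<lambda>l\<in>{1..n}. rv_query C l \<omega>), rv_index \<omega>)"

definition is_ir_scheme :: "nat \<Rightarrow> nat \<Rightarrow> ('s, 'x, 'a, 'q) ir_scheme \<Rightarrow> bool" where
  "is_ir_scheme N n C \<longleftrightarrow>
     finite (file_alphabet C) \<and> card (file_alphabet C) \<ge> 2 \<and> file_len C \<ge> 1 \<and>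
     finite (ans_alphabet C) \<and> ans_alphabet C \<noteq> {} \<and>
     prob_space (strategy C) \<and>
     (\<forall>l\<in>{1..n}. \<forall>m\<in>{1..N}.
        query_fun C l m \<in> measurable (strategy C) (count_space (query_set C l))) \<and>
     (\<forall>l\<in>{1..n}. \<forall>q\<in>query_set C l. \<forall>x\<in>file_tuples N C.
        set (ans_fun C l q x) \<subseteq> ans_alphabet C \<and>
        length (ans_fun C l q x) = ans_len C l q) \<and>
     information_space.conditional_entropy_Pow (ir_space N C) 2
       rv_requested_file (rv_observation n C) = 0"

definition index_query_MI :: "nat \<Rightarrow> ('s, 'x, 'a, 'q) ir_scheme \<Rightarrow> nat \<Rightarrow> real" where
  "index_query_MI N C l =
     information_space.mutual_information_Pow (ir_space N C) 2 rv_index (rv_query C l)"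

definition MI_leakage :: "nat \<Rightarrow> nat \<Rightarrow> ('s, 'x, 'a, 'q) ir_scheme \<Rightarrow> real" where
  "MI_leakage N n C = 1 / real n * (\<Sum>l = 1..n. index_query_MI N C l)"

definition download_cost :: "nat \<Rightarrow> nat \<Rightarrow> ('s, 'x, 'a, 'q) ir_scheme \<Rightarrow> real" where
  "download_cost N n C =
     log 2 (real (card (ans_alphabet C))) *
     (\<Sum>l = 1..n. prob_space.expectation (ir_space N C)
        (\<lambda>\<omega>. real (ans_len C l (rv_query C l \<omega>))))"

definition ir_rate :: "nat \<Rightarrow> nat \<Rightarrow> ('s, 'x, 'a, 'q) ir_scheme \<Rightarrow> real" where
  "ir_rate N n C =
     real (file_len C) * log 2 (real (card (file_alphabet C))) / download_cost N n C"

text \<open>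
  The set of values of the answer of server \<open>l\<close>. The answer of length 0 is identified with a fixed
  other value and hence does not count as a separate one, unless it is the only value.
\<close>

definition answer_values :: "nat \<Rightarrow> ('s, 'x, 'a, 'q) ir_scheme \<Rightarrow> nat \<Rightarrow> 'a list set" where
  "answer_values N C l =
     (let V = rv_answer C l ` space (ir_space N C) in if V = {[]} then V else V - {[]})"

definition admissible :: "real \<Rightarrow> ('s, 'x, 'a, 'q) ir_scheme \<Rightarrow> bool" where
  "admissible \<rho> C \<longleftrightarrow>
     is_ir_scheme 2 2 C \<and>
     (\<exists>\<alpha>::nat. \<forall>l\<in>{1, 2}.
        finite (query_set C l) \<and> card (query_set C l) \<le> \<alpha> \<and>
        finite (answer_values 2 C l) \<and>
        card (answer_values 2 C l) \<le> card (file_alphabet C) ^ file_len C) \<and>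
     MI_leakage 2 2 C \<le> \<rho> \<and>
     (\<exists>l\<in>{1, 2}. index_query_MI 2 C l = 0)"

end

theory Submission
  imports Defs "HOL-Real_Asymp.Real_Asymp"
begin

text \<open>
  Converse: write \<open>L\<close> for the size of a file in bits. Given the queries and the index \<open>m\<close>, the two
  answers determine file \<open>m\<close>, so their download is at least \<open>L\<close> plus the logarithmic number of values
  that either one of them still takes once file \<open>m\<close> is fixed (averaged over file \<open>m\<close>). If the same pair
  of queries can be sent for the other index, these two interference terms add up to at least \<open>L\<close>.
  A nonleaking query has the same law for both indices; for the leaking query \<open>Q\<close> only the mass
  common to both laws can be exchanged, so the download is at least \<open>L (1 + E min(p_Q, 1 - p_Q))\<close> with
  \<open>p_Q = P(M = 1 | Q)\<close>. Jensen's inequality for the binary entropy bounds the binary entropy of this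
  expectation below by \<open>1 - I(M; Q)\<close>.

  Achievability: with probability \<open>1 - e\<close> one server is silent and the other returns the requested
  bit, otherwise the first one returns the sum of both bits and the other one the unwanted bit.
\<close>

section \<open>Binary entropy\<close>

text \<open>Only the point 0 needs care: there x log x tends to 0, in agreement with
  \<open>0 * log 2 0 = 0\<close>.\<close>

lemma continuous_on_mult_log: "continuous_on {0..1::real} (\<lambda>x. x * log 2 x)"
  unfolding continuous_on_def
proof
  fix x :: real assume x: "x \<in> {0..1}"
  show "((\<lambda>x. x * log 2 x) \<longlongrightarrow> x * log 2 x) (at x within {0..1})"
  proof (cases "x = 0")
    case True
    have "((\<lambda>x::real. x * log 2 x) \<longlongrightarrow> 0) (at_right 0)"
      unfolding log_def by real_asymp
    with True show ?thesis by (simp add: at_within_Icc_at_right)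
  next
    case False
    with x show ?thesis by (intro tendsto_intros) auto
  qed
qed

lemma continuous_on_binary_entropy: "continuous_on {0..1} binary_entropy"
proof -
  have "continuous_on {0..1} (\<lambda>x::real. (1 - x) * log 2 (1 - x))"
    by (rule continuous_on_compose2[OF continuous_on_mult_log]) (auto intro: continuous_intros)
  with continuous_on_mult_log
  have "continuous_on {0..1} (\<lambda>x. - (x * log 2 x) - (1 - x) * log 2 (1 - x))"
    by (intro continuous_on_diff continuous_on_minus)
  then show ?thesis by (simp add: binary_entropy_def[abs_def])
qed

lemma binary_entropy_0 [simp]: "binary_entropy 0 = 0"
  and binary_entropy_half [simp]: "binary_entropy (1 / 2) = 1"
  and binary_entropy_compl: "binary_entropy (1 - p) = binary_entropy p"
  by (simp_all add: binary_entropy_def log_divide algebra_simps)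

text \<open>The derivative log ((1 - x) / x) is positive below 1/2. It blows up at 0, hence the
  derivative test on the open interval together with continuity on the closed one.\<close>

lemma binary_entropy_strict_mono:
  assumes "0 \<le> a" "a < b" "b \<le> 1 / 2"
  shows "binary_entropy a < binary_entropy b"
proof (rule DERIV_pos_imp_increasing_open[OF assms(2)])
  fix x assume x: "a < x" "x < b"
  have d: "((\<lambda>x. x * log 2 x) has_real_derivative log 2 y + 1 / ln 2) (at y)" if "y > 0" for y :: real
    using that by (auto intro!: derivative_eq_intros)
  have "((\<lambda>x. - (x * log 2 x) - (1 - x) * log 2 (1 - x)) has_real_derivative
      - (log 2 x + 1 / ln 2) - (log 2 (1 - x) + 1 / ln 2) * (0 - 1)) (at x)"
    using x assms by (intro DERIV_diff DERIV_minus d DERIV_chain2[OF d] DERIV_const DERIV_ident) auto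
  then have "(binary_entropy has_real_derivative log 2 (1 - x) - log 2 x) (at x)"
    by (simp add: binary_entropy_def[abs_def])
  moreover have "log 2 (1 - x) - log 2 x > 0"
    using x assms by simp
  ultimately show "\<exists>y. (binary_entropy has_real_derivative y) (at x) \<and> y > 0" by blast
next
  show "continuous_on {a..b} binary_entropy"
    using assms by (intro continuous_on_subset[OF continuous_on_binary_entropy]) auto
qed

lemma binary_entropy_le_iff:
  assumes "a \<in> {0..1/2}" "b \<in> {0..1/2}"
  shows "binary_entropy a \<le> binary_entropy b \<longleftrightarrow> a \<le> b"
  using binary_entropy_strict_mono[of a b] binary_entropy_strict_mono[of b a] assms
  by (cases a b rule: linorder_cases) auto

lemma binary_entropy_le_1:
  assumes "0 \<le> a" "a \<le> 1 / 2"
  shows "binary_entropy a \<le> 1"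
  using binary_entropy_le_iff[of a "1/2"] assms by simp

text \<open>Monotonicity gives injectivity and the intermediate value theorem surjectivity. This
  makes \<open>binary_entropy_inv\<close> a genuine inverse.\<close>

lemma bij_betw_binary_entropy: "bij_betw binary_entropy {0..1/2} {0..1}"
  unfolding bij_betw_def
proof
  show "inj_on binary_entropy {0..1/2}"
    by (intro inj_onI) (metis binary_entropy_le_iff dual_order.refl order_antisym)
  show "binary_entropy ` {0..1/2} = {0..1}"
  proof
    show "binary_entropy ` {0..1/2} \<subseteq> {0..1}"
      using binary_entropy_le_1 binary_entropy_le_iff[of 0] by auto
    show "{0..1} \<subseteq> binary_entropy ` {0..1/2}"
    proof
      fix y :: real assume "y \<in> {0..1}"
      then have "\<exists>x. 0 \<le> x \<and> x \<le> 1/2 \<and> binary_entropy x = y"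
        by (intro IVT' continuous_on_subset[OF continuous_on_binary_entropy]) auto
      then show "y \<in> binary_entropy ` {0..1/2}" by auto
    qed
  qed
qed

lemma binary_entropy_inv:
  assumes "y \<in> {0..1}"
  shows "binary_entropy_inv y \<in> {0..1/2}" "binary_entropy (binary_entropy_inv y) = y"
proof -
  show "binary_entropy_inv y \<in> {0..1/2}"
    unfolding binary_entropy_inv_def
    using bij_betw_the_inv_into[OF bij_betw_binary_entropy] assms by (rule bij_betwE[rule_format])
  show "binary_entropy (binary_entropy_inv y) = y"
    unfolding binary_entropy_inv_def
    using bij_betw_binary_entropy assms by (rule f_the_inv_into_f_bij_betw)
qed

text \<open>Gibbs' inequality for two points: ln t \<le> t - 1 is applied with t = e / p and with t
  = (1 - e) / (1 - p), and the two linear errors cancel. A zero weight contributes nothing on the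
  left.\<close>

lemma binary_entropy_le_cross_entropy:
  assumes "0 \<le> p" "p \<le> 1" "0 < e" "e < 1"
  shows "binary_entropy p \<le> - p * log 2 e - (1 - p) * log 2 (1 - e)"
proof -
  have *: "x * (log 2 e - log 2 x) \<le> (e - x) / ln 2" if "0 \<le> x" "0 < e" for x e :: real
  proof (cases "x = 0")
    case False
    with that have "ln (e / x) \<le> e / x - 1" by (intro ln_le_minus_one) auto
    with that False have "x * (ln e - ln x) \<le> e - x"
      by (simp add: ln_div field_simps)
    then have "x * (ln e - ln x) / ln 2 \<le> (e - x) / ln 2"
      by (intro divide_right_mono) auto
    then show ?thesis by (simp add: log_def flip: diff_divide_distrib)
  qed (use that in auto)
  have "p * (log 2 e - log 2 p) + (1 - p) * (log 2 (1 - e) - log 2 (1 - p))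
    \<le> (e - p) / ln 2 + ((1 - e) - (1 - p)) / ln 2"
    using assms by (intro add_mono *) auto
  also have "\<dots> = 0" by (simp add: field_simps)
  finally show ?thesis by (simp add: binary_entropy_def algebra_simps)
qed

text \<open>Jensen's inequality, since the cross entropy is the tangent line at the mean.\<close>

lemma sum_binary_entropy_le:
  assumes "finite S" and w: "\<And>i. i \<in> S \<Longrightarrow> w i \<ge> 0" and "sum w S = 1"
    and p: "\<And>i. i \<in> S \<Longrightarrow> p i \<in> {0..1/2}"
  shows "(\<Sum>i\<in>S. w i * binary_entropy (p i)) \<le> binary_entropy (\<Sum>i\<in>S. w i * p i)"
proof (cases "(\<Sum>i\<in>S. w i * p i) = 0")
  \<comment> \<open>A zero mean is treated apart: the entropy has a vertical tangent at 0, so the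
    cross-entropy bound is available only for e > 0.\<close>
  case True
  then have "\<forall>i\<in>S. w i * p i = 0"
    using assms by (subst (asm) sum_nonneg_eq_0_iff) auto
  then have "(\<Sum>i\<in>S. w i * binary_entropy (p i)) = 0"
    by (intro sum.neutral) auto
  with True show ?thesis by simp
next
  case False
  define e where "e = (\<Sum>i\<in>S. w i * p i)"
  have "e \<ge> 0" unfolding e_def using assms by (intro sum_nonneg) auto
  have "e \<le> (\<Sum>i\<in>S. w i * (1/2))" unfolding e_def
    using assms by (intro sum_mono mult_left_mono) auto
  also have "\<dots> = 1/2" using \<open>sum w S = 1\<close> by (simp flip: sum_distrib_right sum_divide_distrib)
  finally have e: "0 < e" "e < 1" using False \<open>e \<ge> 0\<close> by (auto simp: e_def)
  have "(\<Sum>i\<in>S. w i * binary_entropy (p i)) \<le>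
    (\<Sum>i\<in>S. w i * (- p i * log 2 e - (1 - p i) * log 2 (1 - e)))"
    using p w e by (intro sum_mono mult_left_mono binary_entropy_le_cross_entropy) force+
  also have "\<dots> = (\<Sum>i\<in>S. - log 2 e * (w i * p i) - log 2 (1 - e) * (w i - w i * p i))"
    by (intro sum.cong) (auto simp: algebra_simps)
  also have "\<dots> = - log 2 e * e - log 2 (1 - e) * (1 - e)"
    by (simp only: sum_subtractf e_def \<open>sum w S = 1\<close> flip: sum_distrib_left)
  finally show ?thesis by (simp add: binary_entropy_def e_def algebra_simps)
qed

text \<open>The contribution of one query to the mutual information, where \<open>a\<close> and \<open>b\<close> are its
  probabilities given the two values of the index.\<close>

definition mi_term :: "real \<Rightarrow> real \<Rightarrow> real" where
  "mi_term a b = (a + b) / 2 * (1 - binary_entropy (min a b / (a + b)))"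

lemma min_quotient_range:
  fixes a b :: real
  assumes "a \<ge> 0" "b \<ge> 0"
  shows "min a b / (a + b) \<in> {0..1/2}"
  using assms by (cases "a + b = 0") (auto simp: field_simps min_def)

text \<open>The summands on the right are those of the mutual information for joint probabilities
  a/2, b/2 and marginals 1/2, (a + b)/2. As the binary entropy is symmetric about 1/2, the smaller
  posterior may be taken, which lies in the range of \<open>binary_entropy_inv\<close>.\<close>

lemma mi_term_eq:
  assumes "a \<ge> 0" "b \<ge> 0"
  shows "mi_term a b =
    a / 2 * log 2 (a / 2 / (1 / 2 * ((a + b) / 2))) + b / 2 * log 2 (b / 2 / (1 / 2 * ((a + b) / 2)))"
proof (cases "a + b = 0")
  case True
  with assms have "a = 0" "b = 0" by auto
  then show ?thesis by (simp add: mi_term_def)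
next
  case False
  with assms have s: "a + b > 0" by linarith
  have compl: "1 - a / (a + b) = b / (a + b)" using s by (simp add: field_simps)
  have "binary_entropy (min a b / (a + b)) = binary_entropy (a / (a + b))"
    using binary_entropy_compl[of "a / (a + b)"] by (auto simp: min_def compl)
  also have "\<dots> = - (a / (a + b)) * log 2 (a / (a + b)) - (b / (a + b)) * log 2 (b / (a + b))"
    by (simp add: binary_entropy_def compl)
  finally have H: "binary_entropy (min a b / (a + b)) = \<dots>" .
  have l: "x * log 2 (x / 2 / (1 / 2 * ((a + b) / 2))) = x * (1 + log 2 (x / (a + b)))"
    if "x \<ge> 0" for x
  proof (cases "x = 0")
    case False
    with that have "x / (a + b) > 0" using s by simp
    then have "log 2 (2 * (x / (a + b))) = 1 + log 2 (x / (a + b))"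
      by (subst log_mult) auto
    then show ?thesis by (simp add: field_simps)
  qed auto
  have "(a + b) * (1 - binary_entropy (min a b / (a + b))) =
    a * (1 + log 2 (a / (a + b))) + b * (1 + log 2 (b / (a + b)))"
  proof -
    define u v where "u = log 2 (a / (a + b))" and "v = log 2 (b / (a + b))"
    have "(a + b) * (1 - (- (a / (a + b)) * u - (b / (a + b)) * v)) = a * (1 + u) + b * (1 + v)"
    proof -
      have "(a + b) * (x / (a + b) * y) = x * y" for x y using s by simp
      from this[of a u] this[of b v] show ?thesis by (simp add: ring_distribs)
    qed
    then show ?thesis unfolding H u_def v_def .
  qed
  then show ?thesis using l[OF assms(1)] l[OF assms(2)] by (simp add: mi_term_def field_simps)
qed

lemma mi_term_nonneg:
  assumes "a \<ge> 0" "b \<ge> 0"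
  shows "mi_term a b \<ge> 0"
  using assms min_quotient_range[OF assms] binary_entropy_le_1
  by (auto simp: mi_term_def intro!: mult_nonneg_nonneg)

text \<open>On [0, 1/2] the binary entropy reaches 1 only at 1/2. Thus zero leakage makes each query
  equally likely under both indices.\<close>

lemma mi_term_eq_0_iff:
  assumes "a \<ge> 0" "b \<ge> 0"
  shows "mi_term a b = 0 \<longleftrightarrow> a = b"
proof (cases "a + b = 0")
  case True
  with assms have "a = 0" "b = 0" by auto
  then show ?thesis by (simp add: mi_term_def)
next
  case False
  with assms have s: "a + b > 0" by linarith
  have "mi_term a b = 0 \<longleftrightarrow> binary_entropy (min a b / (a + b)) = binary_entropy (1/2)"
    using s by (auto simp: mi_term_def)
  also have "\<dots> \<longleftrightarrow> min a b / (a + b) = 1/2"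
    using min_quotient_range[OF assms] bij_betw_binary_entropy
    by (subst inj_on_eq_iff[of binary_entropy "{0..1/2}"]) (auto simp: bij_betw_def)
  also have "\<dots> \<longleftrightarrow> a = b" using s by (auto simp: min_def field_simps)
  finally show ?thesis .
qed

text \<open>With \<open>w\<close> the law of the query and \<open>p\<close> the smaller posterior
  probability of an index, the mean of \<open>p\<close> is half the overlap of \<open>f\<close> and
  \<open>g\<close>. Jensen bounds its entropy below by 1 - 2r, and monotonicity on [0, 1/2] inverts
  this. The bound is 2r because the leakage averages over two servers, one of which contributes
  0.\<close>

lemma sum_min_ge_binary_entropy_inv:
  fixes f g :: "'q \<Rightarrow> real"
  assumes "finite S" and f: "\<And>q. q \<in> S \<Longrightarrow> f q \<ge> 0" "sum f S = 1"
    and g: "\<And>q. q \<in> S \<Longrightarrow> g q \<ge> 0" "sum g S = 1"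
    and r: "0 \<le> r" "r \<le> 1 / 2" and le: "(\<Sum>q\<in>S. mi_term (f q) (g q)) \<le> 2 * r"
  shows "binary_entropy_inv (1 - 2 * r) \<le> (\<Sum>q\<in>S. min (f q) (g q)) / 2"
proof -
  define w where "w q = (f q + g q) / 2" for q
  define p where "p q = min (f q) (g q) / (f q + g q)" for q
  have w1: "sum w S = 1" by (simp add: w_def f g sum.distrib flip: sum_divide_distrib)
  have w0: "\<And>q. q \<in> S \<Longrightarrow> w q \<ge> 0" by (simp add: w_def f g)
  have p0: "\<And>q. q \<in> S \<Longrightarrow> p q \<in> {0..1/2}" unfolding p_def using f g min_quotient_range by blast
  have wp: "w q * p q = min (f q) (g q) / 2" if "q \<in> S" for q
  proof (cases "f q + g q = 0")
    case True
    with f(1)[OF that] g(1)[OF that] have "f q = 0" "g q = 0" by auto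
    then show ?thesis by (simp add: w_def)
  next
    case False
    have "s / 2 * (x / s) = x / 2" if "s \<noteq> 0" for s x :: real using that by simp
    from this[OF False] show ?thesis by (simp only: w_def p_def)
  qed
  have E: "(\<Sum>q\<in>S. w q * p q) = (\<Sum>q\<in>S. min (f q) (g q)) / 2"
    by (simp add: wp sum_divide_distrib cong: sum.cong)
  have "1 - 2 * r \<le> 1 - (\<Sum>q\<in>S. w q * (1 - binary_entropy (p q)))"
    using le by (simp add: mi_term_def w_def p_def)
  also have "\<dots> = (\<Sum>q\<in>S. w q * binary_entropy (p q))"
    by (simp add: right_diff_distrib sum_subtractf w1)
  also have "\<dots> \<le> binary_entropy (\<Sum>q\<in>S. w q * p q)"
    using assms(1) w0 w1 p0 by (rule sum_binary_entropy_le)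
  finally have *: "binary_entropy (binary_entropy_inv (1 - 2 * r)) \<le> binary_entropy (\<Sum>q\<in>S. w q * p q)"
    using r by (simp add: binary_entropy_inv)
  have "(\<Sum>q\<in>S. w q * p q) \<le> (\<Sum>q\<in>S. w q * (1/2))"
    using w0 p0 by (intro sum_mono mult_left_mono) auto
  also have "\<dots> = 1/2" by (simp add: w1 flip: sum_divide_distrib)
  finally have "(\<Sum>q\<in>S. w q * p q) \<in> {0..1/2}" using w0 p0 by (auto intro!: sum_nonneg)
  moreover have "binary_entropy_inv (1 - 2 * r) \<in> {0..1/2}"
    using r by (intro binary_entropy_inv) auto
  ultimately show ?thesis using * by (simp add: binary_entropy_le_iff E)
qed

section \<open>Counting answers\<close>

text \<open>\<open>J m\<close> is the joint law of the two queries given the index \<open>m\<close>, and the first query does not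
  leak. \<open>r\<close> and \<open>s\<close> measure how much each answer reveals about the other file; \<open>d\<close> is the download.
  Averaging the two bounds on \<open>d\<close> leaves terms weighted by index \<open>m\<close>; these are moved to index
  \<open>3 - m\<close>, where \<open>rs\<close> applies, at no cost for \<open>r\<close> and by the factor \<open>c\<close> below for \<open>s\<close>.\<close>

lemma sum_download_ge:
  fixes J :: "nat \<Rightarrow> 'p \<Rightarrow> 'q \<Rightarrow> real"
  assumes fin: "finite A" "finite B"
    and J0: "\<And>m p q. m \<in> {1, 2} \<Longrightarrow> p \<in> A \<Longrightarrow> q \<in> B \<Longrightarrow> J m p q \<ge> 0"
    and J1: "\<And>m. m \<in> {1, 2} \<Longrightarrow> (\<Sum>p\<in>A. \<Sum>q\<in>B. J m p q) = 1"
    and noleak: "\<And>p. p \<in> A \<Longrightarrow> (\<Sum>q\<in>B. J 1 p q) = (\<Sum>q\<in>B. J 2 p q)"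
    and r0: "\<And>m p. m \<in> {1, 2} \<Longrightarrow> p \<in> A \<Longrightarrow> r m p \<ge> 0"
    and s0: "\<And>m q. m \<in> {1, 2} \<Longrightarrow> q \<in> B \<Longrightarrow> s m q \<ge> 0"
    and d: "\<And>m p q. m \<in> {1, 2} \<Longrightarrow> p \<in> A \<Longrightarrow> q \<in> B \<Longrightarrow> J m p q > 0 \<Longrightarrow>
              L + r m p \<le> d p q \<and> L + s m q \<le> d p q"
    and rs: "\<And>m p q. m \<in> {1, 2} \<Longrightarrow> p \<in> A \<Longrightarrow> q \<in> B \<Longrightarrow> J m p q > 0 \<Longrightarrow>
              L \<le> r (3 - m) p + s (3 - m) q"
  shows "(\<Sum>m\<in>{1, 2}. \<Sum>p\<in>A. \<Sum>q\<in>B. J m p q * d p q) / 2 \<ge>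
         L * (1 + (\<Sum>q\<in>B. min (\<Sum>p\<in>A. J 1 p q) (\<Sum>p\<in>A. J 2 p q)) / 2)"
proof -
  define \<mu> where "\<mu> m p = (\<Sum>q\<in>B. J m p q)" for m p
  define \<nu> where "\<nu> m q = (\<Sum>p\<in>A. J m p q)" for m q
  define mn where "mn q = min (\<nu> 1 q) (\<nu> 2 q)" for q
  have \<nu>0: "\<nu> m q \<ge> 0" if "m \<in> {1,2}" "q \<in> B" for m q
    unfolding \<nu>_def using that J0 by (intro sum_nonneg) auto
  have inter: "L * (\<Sum>q\<in>B. mn q) \<le> (\<Sum>p\<in>A. \<mu> m p * r m p) + (\<Sum>q\<in>B. \<nu> m q * s m q)"
    if m: "m \<in> {1, 2}" for m
  proof -
    let ?k = "3 - m"
    have k: "?k \<in> {1, 2}" "3 - ?k = m" using m by auto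
    \<comment> \<open>\<open>c q\<close> is the fraction of the mass of q under index 3 - m that is
      common to both laws. Where that mass is 0, the quotient is 0 and so is
      \<open>mn q\<close>.\<close>
    define c where "c q = mn q / \<nu> ?k q" for q
    have mn_le: "mn q \<le> \<nu> ?k q" "mn q \<le> \<nu> m q" for q using m by (auto simp: mn_def)
    have mn0: "mn q \<ge> 0" if "q \<in> B" for q using \<nu>0[of 1 q] \<nu>0[of 2 q] that by (auto simp: mn_def)
    have c\<nu>: "c q * \<nu> ?k q = mn q" if "q \<in> B" for q
      using mn_le(1)[of q] mn0[OF that] by (auto simp: c_def)
    have c01: "0 \<le> c q" "c q \<le> 1" if "q \<in> B" for q
      using mn_le(1)[of q] mn0[OF that] \<nu>0[OF k(1) that]
      by (auto simp: c_def divide_le_eq_1 intro: divide_nonneg_nonneg)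
    have "L * (\<Sum>q\<in>B. mn q) = (\<Sum>q\<in>B. \<Sum>p\<in>A. J ?k p q * (c q * L))"
      by (simp add: sum_distrib_left c\<nu>[symmetric] \<nu>_def sum_distrib_right mult_ac cong: sum.cong)
    also have "\<dots> \<le> (\<Sum>q\<in>B. \<Sum>p\<in>A. J ?k p q * (r m p + c q * s m q))"
    proof (intro sum_mono)
      fix q p assume qp: "q \<in> B" "p \<in> A"
      show "J ?k p q * (c q * L) \<le> J ?k p q * (r m p + c q * s m q)"
      proof (cases "J ?k p q > 0")
        case True
        have "c q * L \<le> c q * (r m p + s m q)"
          using rs[OF k(1) qp(2,1) True] k(2) c01[OF qp(1)] by (intro mult_left_mono) auto
        \<comment> \<open>The weight stays on \<open>s\<close>, whose law changes with the index,
          and is dropped from \<open>r\<close>, as \<open>c q\<close> is at most 1 and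
          \<open>r\<close> is nonnegative.\<close>
        also have "\<dots> \<le> r m p + c q * s m q"
          using c01[OF qp(1)] r0[OF m qp(2)] mult_right_mono[of "c q" 1 "r m p"]
          by (simp add: algebra_simps)
        finally show ?thesis using True by (intro mult_left_mono) auto
      next
        case False
        then show ?thesis using J0[OF k(1) qp(2,1)] by simp
      qed
    qed
    also have "\<dots> = (\<Sum>q\<in>B. \<Sum>p\<in>A. J ?k p q * r m p) + (\<Sum>q\<in>B. \<Sum>p\<in>A. J ?k p q * (c q * s m q))"
      by (simp add: distrib_left sum.distrib)
    also have "(\<Sum>q\<in>B. \<Sum>p\<in>A. J ?k p q * r m p) = (\<Sum>p\<in>A. \<mu> ?k p * r m p)"
      by (subst sum.swap) (simp add: \<mu>_def sum_distrib_right)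
    \<comment> \<open>The nonleaking query has the same law for both indices, so 3 - m is exchanged
      for m without loss.\<close>
    also have "\<dots> = (\<Sum>p\<in>A. \<mu> m p * r m p)"
      using m noleak by (intro sum.cong) (auto simp: \<mu>_def)
    also have "(\<Sum>q\<in>B. \<Sum>p\<in>A. J ?k p q * (c q * s m q)) = (\<Sum>q\<in>B. c q * \<nu> ?k q * s m q)"
      by (intro sum.cong refl) (simp add: \<nu>_def sum_distrib_right sum_distrib_left mult_ac)
    \<comment> \<open>For the leaking query only the common mass \<open>mn\<close> is left, and it
      is dominated by the law under index m.\<close>
    also have "\<dots> \<le> (\<Sum>q\<in>B. \<nu> m q * s m q)"
      using s0[OF m] mn_le(2) by (intro sum_mono mult_right_mono) (auto simp: c\<nu>)
    finally show ?thesis by simp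
  qed
  have down: "L + ((\<Sum>p\<in>A. \<mu> m p * r m p) + (\<Sum>q\<in>B. \<nu> m q * s m q)) / 2
      \<le> (\<Sum>p\<in>A. \<Sum>q\<in>B. J m p q * d p q)" if m: "m \<in> {1, 2}" for m
  proof -
    have "L = (\<Sum>p\<in>A. \<Sum>q\<in>B. J m p q * L)"
      using J1[OF m] by (simp flip: sum_distrib_right)
    moreover have "(\<Sum>p\<in>A. \<mu> m p * r m p) / 2 = (\<Sum>p\<in>A. \<Sum>q\<in>B. J m p q * (r m p / 2))"
      by (simp add: \<mu>_def sum_distrib_right sum_divide_distrib)
    moreover have "(\<Sum>q\<in>B. \<nu> m q * s m q) / 2 = (\<Sum>p\<in>A. \<Sum>q\<in>B. J m p q * (s m q / 2))"
      by (subst sum.swap) (simp add: \<nu>_def sum_distrib_right sum_divide_distrib)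
    ultimately have "L + ((\<Sum>p\<in>A. \<mu> m p * r m p) + (\<Sum>q\<in>B. \<nu> m q * s m q)) / 2 =
      (\<Sum>p\<in>A. \<Sum>q\<in>B. J m p q * (L + r m p / 2 + s m q / 2))"
      unfolding distrib_left sum.distrib add_divide_distrib by linarith
    also have "\<dots> \<le> (\<Sum>p\<in>A. \<Sum>q\<in>B. J m p q * d p q)"
    proof (intro sum_mono)
      fix p q assume pq: "p \<in> A" "q \<in> B"
      show "J m p q * (L + r m p / 2 + s m q / 2) \<le> J m p q * d p q"
      proof (cases "J m p q > 0")
        case True
        with d[OF m pq] have "L + r m p / 2 + s m q / 2 \<le> d p q" by linarith
        with True show ?thesis by (intro mult_left_mono) auto
      qed (use J0[OF m pq] in simp)
    qed
    finally show ?thesis .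
  qed
  \<comment> \<open>Add over both indices and halve: each \<open>down\<close> contains half an
    interference sum, which \<open>inter\<close> bounds below by L times the overlap.\<close>
  show ?thesis
    using inter[of 1] inter[of 2] down[of 1] down[of 2]
    by (simp add: mn_def \<nu>_def algebra_simps add_divide_distrib)
qed

section \<open>Counting answers with one file held fixed\<close>

text \<open>Concavity of the logarithm. It is needed because \<open>interference\<close> averages
  logarithms, whereas counting answer pairs adds the counts themselves.\<close>

lemma sum_log_le_log_sum:
  fixes f :: "'a \<Rightarrow> real"
  assumes "finite W" "W \<noteq> {}" "\<And>w. w \<in> W \<Longrightarrow> f w > 0"
  shows "(\<Sum>w\<in>W. log 2 (f w)) / card W \<le> log 2 ((\<Sum>w\<in>W. f w) / card W)"
proof -
  have "(\<Sum>w\<in>W. (1 / card W) * log 2 (f w)) \<le> log 2 (\<Sum>w\<in>W. (1 / card W) *\<^sub>R f w)"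
    using assms concave_on_sum[of W "{0<..}" "log 2" "\<lambda>_. 1 / card W" f] log_concave[of 2] by auto
  then show ?thesis by (simp add: sum_divide_distrib)
qed

text \<open>Plays the role of the entropy of the answer \<open>f\<close> given the file \<open>x m = w\<close>, averaged
  over \<open>w\<close>; counting values instead of measuring entropy suffices here.\<close>

definition interference :: "'x set \<Rightarrow> (nat \<Rightarrow> 'x) set \<Rightarrow> nat \<Rightarrow> ((nat \<Rightarrow> 'x) \<Rightarrow> 'a) \<Rightarrow> real" where
  "interference W T m f = (\<Sum>w\<in>W. log 2 (card (f ` {x \<in> T. x m = w}))) / card W"

context
  fixes W :: "'x set" and T :: "(nat \<Rightarrow> 'x) set"
  assumes finW: "finite W" and W_ne: "W \<noteq> {}"
  defines "T \<equiv> {1..2} \<rightarrow>\<^sub>E W"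
begin

lemma finite_T: "finite T"
  unfolding T_def using finW by (intro finite_PiE) auto

lemma pair_tuple:
  assumes "m \<in> {1, 2}" "w \<in> W" "v \<in> W"
  shows "\<exists>x\<in>T. x m = w \<and> x (3 - m) = v"
proof
  let ?x = "\<lambda>i\<in>{1..2}. if i = m then w else v"
  show "?x \<in> T" unfolding T_def using assms by auto
  show "?x m = w \<and> ?x (3 - m) = v" using assms by auto
qed

lemma slice_card_pos:
  assumes "m \<in> {1, 2}" "w \<in> W"
  shows "card (f ` {x \<in> T. x m = w}) \<ge> 1"
proof -
  have "{x \<in> T. x m = w} \<noteq> {}" using pair_tuple[OF assms, of w] assms by blast
  with finite_T show ?thesis by (simp add: Suc_le_eq card_gt_0_iff)
qed

lemma interference_nonneg:
  assumes "m \<in> {1, 2}"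
  shows "interference W T m f \<ge> 0"
  unfolding interference_def
proof (intro divide_nonneg_nonneg sum_nonneg)
  fix w assume "w \<in> W"
  then have "1 \<le> real (card (f ` {x \<in> T. x m = w}))"
    using slice_card_pos[OF assms] by simp
  then show "0 \<le> log 2 (real (card (f ` {x \<in> T. x m = w})))" by (subst zero_le_log_cancel_iff) auto
qed simp

text \<open>Fix the other file at w. The two answers still determine file m, which runs through all
  of W, so the product of their numbers of values is at least \<open>card W\<close>. Take logarithms
  and average over w.\<close>

lemma interference_add_ge:
  assumes m: "m \<in> {1, 2}"
    and dec: "\<And>x y. x \<in> T \<Longrightarrow> y \<in> T \<Longrightarrow> f x = f y \<Longrightarrow> g x = g y \<Longrightarrow> x m = y m"
  shows "log 2 (card W) \<le> interference W T (3 - m) f + interference W T (3 - m) g"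
proof -
  let ?k = "3 - m"
  have k: "?k \<in> {1, 2}" "3 - ?k = m" using m by auto
  have "log 2 (card W) \<le> log 2 (card (f ` {x \<in> T. x ?k = w})) + log 2 (card (g ` {x \<in> T. x ?k = w}))"
    if w: "w \<in> W" for w
  proof -
    let ?S = "{x \<in> T. x ?k = w}"
    \<comment> \<open>The decoder picks any tuple that produces the given answers; by
      \<open>dec\<close> the choice does not affect file m.\<close>
    obtain h where h: "\<And>x. x \<in> T \<Longrightarrow> h (f x, g x) = x m"
    proof
      fix x assume "x \<in> T"
      then have "\<exists>y. y \<in> T \<and> f y = f x \<and> g y = g x" by blast
      from someI_ex[OF this] show "(\<lambda>(a, b). (SOME y. y \<in> T \<and> f y = a \<and> g y = b) m) (f x, g x) = x m"
        using dec \<open>x \<in> T\<close> by auto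
    qed
    have "W \<subseteq> h ` (f ` ?S \<times> g ` ?S)"
    proof
      fix v assume "v \<in> W"
      then obtain x where "x \<in> ?S" "x m = v" using pair_tuple[OF k(1) w, of v] k(2) by auto
      then show "v \<in> h ` (f ` ?S \<times> g ` ?S)"
        by (intro image_eqI[of _ _ "(f x, g x)"]) (auto simp: h)
    qed
    then have "card W \<le> card (f ` ?S \<times> g ` ?S)"
      by (intro surj_card_le) (use finite_T in auto)
    then have "real (card W) \<le> real (card (f ` ?S)) * real (card (g ` ?S))"
      by (simp add: card_cartesian_product flip: of_nat_mult)
    moreover have "real (card W) > 0" using finW W_ne by (simp add: card_gt_0_iff)
    moreover have "card (f ` ?S) > 0" "card (g ` ?S) > 0"
      using slice_card_pos[OF k(1) w, of f] slice_card_pos[OF k(1) w, of g] by linarith+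
    ultimately have "log 2 (card W) \<le> log 2 (real (card (f ` ?S)) * real (card (g ` ?S)))"
      by (subst log_le_cancel_iff) auto
    also have "\<dots> = log 2 (card (f ` ?S)) + log 2 (card (g ` ?S))"
      using \<open>card (f ` ?S) > 0\<close> \<open>card (g ` ?S) > 0\<close> by (simp add: log_mult)
    finally show ?thesis .
  qed
  then have "(\<Sum>w\<in>W. log 2 (card W)) \<le>
    (\<Sum>w\<in>W. log 2 (card (f ` {x \<in> T. x ?k = w})) + log 2 (card (g ` {x \<in> T. x ?k = w})))"
    by (intro sum_mono) auto
  moreover have "real (card W) > 0" using finW W_ne by (simp add: card_gt_0_iff)
  ultimately show ?thesis
    by (simp add: interference_def sum.distrib pos_le_divide_eq mult.commute flip: add_divide_distrib)
qed

text \<open>Answer pairs for different values of file m are distinct, so their number is at least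
  the sum over w of the number of values of \<open>f\<close> on the slice at w, which is
  \<open>card W\<close> times the mean. Concavity then bounds the logarithm of the mean below by
  \<open>interference\<close>.\<close>

lemma card_answers_ge:
  assumes m: "m \<in> {1, 2}"
    and dec: "\<And>x y. x \<in> T \<Longrightarrow> y \<in> T \<Longrightarrow> f x = f y \<Longrightarrow> g x = g y \<Longrightarrow> x m = y m"
  shows "log 2 (card W) + interference W T m f \<le> log 2 (card ((\<lambda>x. (f x, g x)) ` T))"
proof -
  let ?h = "\<lambda>x. (f x, g x)"
  have pos: "real (card W) > 0" using finW W_ne by (simp add: card_gt_0_iff)
  have fp: "card (f ` {x \<in> T. x m = w}) > 0" if "w \<in> W" for w
    using slice_card_pos[OF m that, of f] by linarith
  have "(\<Sum>w\<in>W. card (f ` {x \<in> T. x m = w})) \<le> (\<Sum>w\<in>W. card (?h ` {x \<in> T. x m = w}))"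
  proof (intro sum_mono)
    fix w
    have "f ` {x \<in> T. x m = w} = fst ` ?h ` {x \<in> T. x m = w}" by (simp add: image_image)
    moreover have "finite (?h ` {x \<in> T. x m = w})" using finite_T by auto
    ultimately show "card (f ` {x \<in> T. x m = w}) \<le> card (?h ` {x \<in> T. x m = w})"
      by (simp only: card_image_le)
  qed
  also have "\<dots> = card (\<Union>w\<in>W. ?h ` {x \<in> T. x m = w})"
  proof (rule card_UN_disjoint[symmetric])
    show "\<forall>w\<in>W. finite (?h ` {x \<in> T. x m = w})" using finite_T by auto
    show "\<forall>w\<in>W. \<forall>v\<in>W. w \<noteq> v \<longrightarrow> ?h ` {x \<in> T. x m = w} \<inter> ?h ` {x \<in> T. x m = v} = {}"
    proof (intro ballI impI)
      fix w v :: 'x assume "w \<noteq> v"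
      show "?h ` {x \<in> T. x m = w} \<inter> ?h ` {x \<in> T. x m = v} = {}"
      proof (rule equals0I)
        fix z assume "z \<in> ?h ` {x \<in> T. x m = w} \<inter> ?h ` {x \<in> T. x m = v}"
        then obtain x y where "x \<in> T" "x m = w" "z = ?h x" "y \<in> T" "y m = v" "z = ?h y" by blast
        with dec[of x y] \<open>w \<noteq> v\<close> show False by simp
      qed
    qed
  qed (fact finW)
  also have "(\<Union>w\<in>W. ?h ` {x \<in> T. x m = w}) = ?h ` T"
  proof -
    have "x m \<in> W" if "x \<in> T" for x using that m unfolding T_def by (auto simp: PiE_iff)
    then show ?thesis by blast
  qed
  finally have le: "(\<Sum>w\<in>W. real (card (f ` {x \<in> T. x m = w}))) \<le> card (?h ` T)"
    by (simp flip: of_nat_sum)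
  have sp: "(\<Sum>w\<in>W. real (card (f ` {x \<in> T. x m = w}))) > 0"
    using finW W_ne fp by (intro sum_pos) auto
  have "log 2 (card W) + interference W T m f \<le>
      log 2 (card W) + log 2 ((\<Sum>w\<in>W. real (card (f ` {x \<in> T. x m = w}))) / card W)"
    unfolding interference_def using finW W_ne fp by (intro add_left_mono sum_log_le_log_sum) auto
  also have "\<dots> = log 2 (\<Sum>w\<in>W. real (card (f ` {x \<in> T. x m = w})))"
    using sp pos by (simp add: log_divide)
  also have "\<dots> \<le> log 2 (card (?h ` T))" using le sp by simp
  finally show ?thesis .
qed

end

section \<open>The probability space of a scheme\<close>

text \<open>All summands - P log (P / Q) are nonnegative because P \<le> Q, so each must vanish. The
  criterion says that conditional probabilities are 0 or 1; written without a quotient, it also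
  covers null values of \<open>Y\<close>.\<close>

lemma (in information_space) conditional_entropy_eq_0_iff_simple:
  assumes X: "simple_function M X" and Y: "simple_function M Y"
  shows "\<H>(X | Y) = 0 \<longleftrightarrow>
    (\<forall>\<omega>\<in>space M. prob ((\<lambda>x. (X x, Y x)) -` {(X \<omega>, Y \<omega>)} \<inter> space M) \<in>
       {0, prob (Y -` {Y \<omega>} \<inter> space M)})"
proof -
  define Q where "Q y = prob (Y -` {y} \<inter> space M)" for y
  define P where "P z = prob ((\<lambda>x. (X x, Y x)) -` {z} \<inter> space M)" for z
  let ?I = "(\<lambda>x. (X x, Y x)) ` space M"
  have PQ: "0 \<le> P z" "P z \<le> Q (snd z)" for z
    unfolding P_def Q_def using simple_functionD(2)[OF Y] by (auto intro!: finite_measure_mono)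
  have eq: "P z * log b (P z / Q (snd z)) = 0 \<longleftrightarrow> P z \<in> {0, Q (snd z)}"
    and le: "P z * log b (P z / Q (snd z)) \<le> 0" for z
  proof -
    have "P z * log b (P z / Q (snd z)) \<le> 0 \<and>
      (P z * log b (P z / Q (snd z)) = 0 \<longleftrightarrow> P z \<in> {0, Q (snd z)})"
    proof (cases "P z = 0")
      case False
      with PQ[of z] have pos: "0 < P z" "0 < Q (snd z)" by auto
      then have "log b (P z / Q (snd z)) \<le> 0"
        using PQ[of z] b_gt_1 by (subst log_le_zero_cancel_iff) auto
      moreover have "log b (P z / Q (snd z)) < 0 \<longleftrightarrow> P z < Q (snd z)"
        using pos b_gt_1 by (subst log_less_zero_cancel_iff) auto
      then have "log b (P z / Q (snd z)) = 0 \<longleftrightarrow> P z = Q (snd z)"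
        using \<open>log b (P z / Q (snd z)) \<le> 0\<close> PQ[of z] by linarith
      ultimately show ?thesis using pos by (auto simp: mult_le_0_iff)
    qed auto
    then show "P z * log b (P z / Q (snd z)) = 0 \<longleftrightarrow> P z \<in> {0, Q (snd z)}"
      and "P z * log b (P z / Q (snd z)) \<le> 0" by auto
  qed
  have fin: "finite ?I" using simple_functionD(1)[OF simple_function_Pair[OF X Y]] .
  have "\<H>(X | Y) = - (\<Sum>(x, y)\<in>?I. P (x, y) * log b (P (x, y) / Q y))"
    by (rule conditional_entropy_eq)
       (auto intro!: simple_distributedI X Y simple_function_Pair simp: P_def Q_def)
  also have "\<dots> = (\<Sum>z\<in>?I. - (P z * log b (P z / Q (snd z))))"
    by (simp add: split_beta sum_negf)
  finally have "\<H>(X | Y) = 0 \<longleftrightarrow> (\<forall>z\<in>?I. - (P z * log b (P z / Q (snd z))) = 0)"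
    using fin le by (simp add: sum_nonneg_eq_0_iff)
  also have "\<dots> \<longleftrightarrow> (\<forall>z\<in>?I. P z \<in> {0, Q (snd z)})"
    using eq by simp
  also have "\<dots> \<longleftrightarrow> (\<forall>\<omega>\<in>space M. P (X \<omega>, Y \<omega>) \<in> {0, Q (Y \<omega>)})" by simp
  finally show ?thesis unfolding P_def Q_def .
qed

lemma (in finite_measure) measure_sum_fibres:
  assumes f: "f \<in> measurable M (count_space B)" and "finite B" and S: "S \<in> sets M"
  shows "measure M S = (\<Sum>b\<in>B. measure M {x \<in> S. f x = b})"
proof -
  have sub: "S \<subseteq> space M" using S by (rule sets.sets_into_space)
  have eq: "{x \<in> S. f x = b} = f -` {b} \<inter> space M \<inter> S" for b using sub by auto
  have "{x \<in> S. f x = b} \<in> sets M" if "b \<in> B" for b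
    unfolding eq using that S by (intro sets.Int measurable_sets[OF f]) auto
  then have "measure M (\<Union>b\<in>B. {x \<in> S. f x = b}) = (\<Sum>b\<in>B. measure M {x \<in> S. f x = b})"
    using \<open>finite B\<close> by (intro finite_measure_finite_Union) (auto simp: disjoint_family_on_def)
  moreover have "(\<Union>b\<in>B. {x \<in> S. f x = b}) = S"
    using measurable_space[OF f] sub by auto
  ultimately show ?thesis by simp
qed

section \<open>The joint law of index, queries and files\<close>

lemma atLeastAtMost_1_2: "{1..2::nat} = {1, 2}"
  by auto

text \<open>Decodability and the answer lengths are left out, so that the optimal scheme can be
  interpreted here before \<open>is_ir_scheme\<close> is established for it.\<close>

locale two_server_scheme =
  fixes C :: "('s, 'x, 'a, 'q) ir_scheme"
  assumes finite_alphabet: "finite (file_alphabet C)"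
    and alphabet_nonempty: "file_alphabet C \<noteq> {}"
    and prob_space_strategy: "prob_space (strategy C)"
    and measurable_query: "\<And>l m. l \<in> {1, 2} \<Longrightarrow> m \<in> {1, 2} \<Longrightarrow>
          query_fun C l m \<in> measurable (strategy C) (count_space (query_set C l))"
    and finite_query_set: "\<And>l. l \<in> {1, 2} \<Longrightarrow> finite (query_set C l)"
begin

sublocale S: prob_space "strategy C"
  by (rule prob_space_strategy)

abbreviation "\<Omega> \<equiv> ir_space 2 C"
abbreviation "T \<equiv> file_tuples 2 C"
abbreviation "words \<equiv> {w. set w \<subseteq> file_alphabet C \<and> length w = file_len C}"

definition joint_event :: "nat \<Rightarrow> 'q \<Rightarrow> 'q \<Rightarrow> 's set" where
  "joint_event m p q = {s \<in> space (strategy C). query_fun C 1 m s = p \<and> query_fun C 2 m s = q}"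

definition query_event :: "nat \<Rightarrow> nat \<Rightarrow> 'q \<Rightarrow> 's set" where
  "query_event l m q = {s \<in> space (strategy C). query_fun C l m s = q}"

abbreviation "joint m p q \<equiv> S.prob (joint_event m p q)"
abbreviation "query_prob l m q \<equiv> S.prob (query_event l m q)"

lemma finite_words: "finite words" and card_words: "card words = card (file_alphabet C) ^ file_len C"
  using finite_alphabet by (simp_all add: finite_lists_length_eq card_lists_length_eq)

lemma words_nonempty: "words \<noteq> {}"
proof -
  obtain a where "a \<in> file_alphabet C" using alphabet_nonempty by auto
  then have "replicate (file_len C) a \<in> words" by auto
  then show ?thesis by blast
qed

lemma finite_tuples: "finite T" and tuples_nonempty: "T \<noteq> {}"
  unfolding file_tuples_def using finite_words words_nonempty
  by (auto intro!: finite_PiE simp: PiE_eq_empty_iff)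

lemma card_tuples_pos: "card T > 0"
  using finite_tuples tuples_nonempty by (simp add: card_gt_0_iff)

lemma prob_space_ir_space: "prob_space \<Omega>"
proof -
  interpret I: prob_space "uniform_count_measure {1..2::nat}"
    by (intro prob_space_uniform_count_measure) auto
  interpret F: prob_space "uniform_count_measure T"
    using finite_tuples tuples_nonempty by (intro prob_space_uniform_count_measure) auto
  interpret P1: pair_prob_space "strategy C" "uniform_count_measure T" ..
  interpret P2: pair_prob_space "uniform_count_measure {1..2::nat}"
    "strategy C \<Otimes>\<^sub>M uniform_count_measure T" ..
  show ?thesis unfolding ir_space_def by (rule P2.prob_space_axioms)
qed

sublocale information_space \<Omega> 2
  using prob_space_ir_space by (simp add: information_space_def information_space_axioms_def)

lemma space_ir_space: "space \<Omega> = {1, 2} \<times> space (strategy C) \<times> T"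
  by (simp add: ir_space_def space_pair_measure space_uniform_count_measure atLeastAtMost_1_2[simplified])

lemma sets_rectangle:
  assumes "m \<in> {1, 2}" "A \<in> sets (strategy C)" "F \<subseteq> T"
  shows "{m} \<times> A \<times> F \<in> sets \<Omega>"
  using assms unfolding ir_space_def
  by (intro pair_measureI) (auto simp: sets_uniform_count_measure)

lemma prob_rectangle:
  assumes "m \<in> {1, 2}" "A \<in> sets (strategy C)" "F \<subseteq> T"
  shows "prob ({m} \<times> A \<times> F) = S.prob A * (card F / card T) / 2"
proof -
  interpret F: prob_space "uniform_count_measure T"
    using finite_tuples tuples_nonempty by (intro prob_space_uniform_count_measure) auto
  interpret P1: pair_prob_space "strategy C" "uniform_count_measure T" ..
  have "prob ({m} \<times> A \<times> F) = measure (uniform_count_measure {1..2::nat}) {m} *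
      measure (strategy C \<Otimes>\<^sub>M uniform_count_measure T) (A \<times> F)"
    unfolding ir_space_def measure_def using assms
    by (subst P1.P.emeasure_pair_measure_Times)
       (auto simp: sets_uniform_count_measure enn2real_mult intro!: pair_measureI)
  also have "measure (strategy C \<Otimes>\<^sub>M uniform_count_measure T) (A \<times> F) =
      S.prob A * measure (uniform_count_measure T) F"
    unfolding measure_def using assms
    by (subst F.emeasure_pair_measure_Times) (auto simp: sets_uniform_count_measure enn2real_mult)
  also have "measure (uniform_count_measure {1..2::nat}) {m} = 1 / 2"
    using assms by (subst measure_uniform_count_measure) auto
  also have "measure (uniform_count_measure T) F = card F / card T"
    using assms finite_tuples by (intro measure_uniform_count_measure)
  finally show ?thesis by simp
qed

lemma query_event_sets:
  assumes "l \<in> {1, 2}" "m \<in> {1, 2}"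
  shows "query_event l m q \<in> sets (strategy C)"
proof (cases "q \<in> query_set C l")
  case True
  have "query_event l m q = query_fun C l m -` {q} \<inter> space (strategy C)"
    by (auto simp: query_event_def)
  then show ?thesis using measurable_sets[OF measurable_query[OF assms], of "{q}"] True by simp
next
  case False
  then have "query_event l m q = {}"
    using measurable_space[OF measurable_query[OF assms]] by (auto simp: query_event_def)
  then show ?thesis by simp
qed

lemma joint_event_eq: "joint_event m p q = query_event 1 m p \<inter> query_event 2 m q"
  by (auto simp: joint_event_def query_event_def)

lemma joint_event_sets:
  assumes "m \<in> {1, 2}"
  shows "joint_event m p q \<in> sets (strategy C)"
  unfolding joint_event_eq using assms query_event_sets by auto

lemma query_prob_1_eq_sum_joint:
  assumes "m \<in> {1, 2}"
  shows "query_prob 1 m p = (\<Sum>q\<in>query_set C 2. joint m p q)"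
  using S.measure_sum_fibres[OF measurable_query[of 2 m] finite_query_set query_event_sets[of 1 m p]] assms
  by (simp add: query_event_def joint_event_def conj_assoc)

lemma query_prob_2_eq_sum_joint:
  assumes "m \<in> {1, 2}"
  shows "query_prob 2 m q = (\<Sum>p\<in>query_set C 1. joint m p q)"
  using S.measure_sum_fibres[OF measurable_query[of 1 m] finite_query_set query_event_sets[of 2 m q]] assms
  by (simp add: query_event_def joint_event_def conj_ac)

lemma sum_query_prob:
  assumes "l \<in> {1, 2}" "m \<in> {1, 2}"
  shows "(\<Sum>q\<in>query_set C l. query_prob l m q) = 1"
  using S.measure_sum_fibres[OF measurable_query[OF assms] finite_query_set[OF assms(1)] sets.top]
  by (simp add: query_event_def S.prob_space)

lemma sum_joint:
  assumes "m \<in> {1, 2}"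
  shows "(\<Sum>p\<in>query_set C 1. \<Sum>q\<in>query_set C 2. joint m p q) = 1"
  using sum_query_prob[of 1 m, unfolded query_prob_1_eq_sum_joint[OF assms]] assms by blast

text \<open>The strategy may be continuous, but this variable takes finitely many values. Index,
  queries, requested file and observation factor through it, which makes them simple
  functions.\<close>

definition rv_data :: "nat \<times> 's \<times> (nat \<Rightarrow> 'x list) \<Rightarrow> nat \<times> 'q \<times> 'q \<times> (nat \<Rightarrow> 'x list)" where
  "rv_data = (\<lambda>(m, s, x). (m, query_fun C 1 m s, query_fun C 2 m s, x))"

lemma rv_data_vimage:
  assumes "m \<in> {1, 2}" "x \<in> T"
  shows "rv_data -` {(m, p, q, x)} \<inter> space \<Omega> = {m} \<times> joint_event m p q \<times> {x}"
  using assms by (auto simp: rv_data_def space_ir_space joint_event_def)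

lemma simple_function_rv_data: "simple_function \<Omega> rv_data"
  unfolding simple_function_def
proof (intro conjI ballI)
  have "rv_data ` space \<Omega> \<subseteq> {1, 2} \<times> query_set C 1 \<times> query_set C 2 \<times> T"
    using measurable_space[OF measurable_query] by (auto simp: rv_data_def space_ir_space)
  then show "finite (rv_data ` space \<Omega>)"
    using finite_query_set finite_tuples by (elim finite_subset) auto
next
  fix z assume "z \<in> rv_data ` space \<Omega>"
  then obtain m p q x where "z = (m, p, q, x)" "m \<in> {1, 2}" "x \<in> T"
    by (auto simp: space_ir_space rv_data_def)
  then show "rv_data -` {z} \<inter> space \<Omega> \<in> sets \<Omega>"
    unfolding \<open>z = (m, p, q, x)\<close> rv_data_vimage[OF \<open>m \<in> {1, 2}\<close> \<open>x \<in> T\<close>]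
    by (intro sets_rectangle joint_event_sets) auto
qed

lemma simple_function_of_data:
  assumes "\<And>\<omega>. f \<omega> = g (rv_data \<omega>)"
  shows "simple_function \<Omega> f"
proof -
  have "f = g \<circ> rv_data" using assms by auto
  then show ?thesis using simple_function_compose[OF simple_function_rv_data] by simp
qed

lemma simple_function_rv_index: "simple_function \<Omega> rv_index"
  by (rule simple_function_of_data[of _ fst]) (auto simp: rv_index_def rv_data_def)

lemma simple_function_rv_query:
  assumes "l \<in> {1, 2}"
  shows "simple_function \<Omega> (rv_query C l)"
  using assms
  by (intro simple_function_of_data[of _ "\<lambda>(m, p, q, x). if l = 1 then p else q"])
     (auto simp: rv_query_def rv_data_def)

lemma simple_function_rv_requested_file: "simple_function \<Omega> rv_requested_file"
  by (rule simple_function_of_data[of _ "\<lambda>(m, p, q, x). x m"])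
     (auto simp: rv_requested_file_def rv_data_def)

lemma simple_function_rv_observation: "simple_function \<Omega> (rv_observation 2 C)"
  by (rule simple_function_of_data[of _ "\<lambda>(m, p, q, x).
        (\<lambda>l\<in>{1..2}. ans_fun C l (if l = 1 then p else q) x, \<lambda>l\<in>{1..2}. if l = 1 then p else q, m)"])
     (auto simp: rv_observation_def rv_index_def rv_query_def rv_answer_def rv_data_def fun_eq_iff
        restrict_def le_less)

section \<open>Leakage, download cost and decodability in terms of query probabilities\<close>

lemma index_query_MI_eq:
  assumes l: "l \<in> {1, 2}"
  shows "index_query_MI 2 C l = (\<Sum>q\<in>query_set C l. mi_term (query_prob l 1 q) (query_prob l 2 q))"
proof -
  let ?Px = "\<lambda>m::nat. 1 / 2 :: real"
  let ?Pq = "\<lambda>q. (query_prob l 1 q + query_prob l 2 q) / 2"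
  let ?Pxq = "\<lambda>(m, q). query_prob l m q / 2"
  let ?t = "\<lambda>(m, q). ?Pxq (m, q) * log 2 (?Pxq (m, q) / (?Px m * ?Pq q))"
  have rect: "prob ({m} \<times> A \<times> T) = S.prob A / 2" if "m \<in> {1, 2}" "A \<in> sets (strategy C)" for m A
    using prob_rectangle[OF that subset_refl] card_tuples_pos by simp
  have X: "simple_distributed \<Omega> rv_index ?Px"
  proof (rule simple_distributedI[OF simple_function_rv_index])
    fix m assume "m \<in> rv_index ` space \<Omega>"
    then have m: "m \<in> {1, 2}" by (auto simp: rv_index_def space_ir_space)
    then have "rv_index -` {m} \<inter> space \<Omega> = {m} \<times> space (strategy C) \<times> T"
      by (auto simp: rv_index_def space_ir_space)
    then show "?Px m = prob (rv_index -` {m} \<inter> space \<Omega>)"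
      using rect[OF m sets.top] by (simp add: S.prob_space)
  qed simp
  have Q: "simple_distributed \<Omega> (rv_query C l) ?Pq"
  proof (rule simple_distributedI[OF simple_function_rv_query[OF l]])
    fix q
    have "rv_query C l -` {q} \<inter> space \<Omega> =
        {1} \<times> query_event l 1 q \<times> T \<union> {2} \<times> query_event l 2 q \<times> T"
      by (auto simp: rv_query_def query_event_def space_ir_space)
    moreover have "prob \<dots> = prob ({1} \<times> query_event l 1 q \<times> T) + prob ({2} \<times> query_event l 2 q \<times> T)"
      using l by (intro finite_measure_Union sets_rectangle query_event_sets) auto
    ultimately show "?Pq q = prob (rv_query C l -` {q} \<inter> space \<Omega>)"
      using l by (simp add: rect query_event_sets add_divide_distrib)
  qed simp
  have XQ: "simple_distributed \<Omega> (\<lambda>\<omega>. (rv_index \<omega>, rv_query C l \<omega>)) ?Pxq"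
  proof (rule simple_distributedI[OF simple_function_Pair[OF simple_function_rv_index simple_function_rv_query[OF l]]])
    fix z assume "z \<in> (\<lambda>\<omega>. (rv_index \<omega>, rv_query C l \<omega>)) ` space \<Omega>"
    then obtain m q where z: "z = (m, q)" and m: "m \<in> {1, 2}"
      by (auto simp: rv_index_def space_ir_space)
    have "(\<lambda>\<omega>. (rv_index \<omega>, rv_query C l \<omega>)) -` {(m, q)} \<inter> space \<Omega> = {m} \<times> query_event l m q \<times> T"
      using m by (auto simp: rv_index_def rv_query_def query_event_def space_ir_space)
    then show "?Pxq z = prob ((\<lambda>\<omega>. (rv_index \<omega>, rv_query C l \<omega>)) -` {z} \<inter> space \<Omega>)"
      using rect[OF m query_event_sets[OF l m]] by (simp add: z)
  qed auto
  have "index_query_MI 2 C l = (\<Sum>z\<in>(\<lambda>\<omega>. (rv_index \<omega>, rv_query C l \<omega>)) ` space \<Omega>. ?t z)"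
    unfolding index_query_MI_def mutual_information_simple_distributed[OF X Q XQ]
    by (intro sum.cong) auto
  \<comment> \<open>Pairs that are not attained have an empty query event, so extending the sum to
    the full product adds only zeros.\<close>
  also have "\<dots> = (\<Sum>z\<in>{1, 2} \<times> query_set C l. ?t z)"
  proof (rule sum.mono_neutral_left)
    show "finite ({1, 2} \<times> query_set C l)" using finite_query_set[OF l] by simp
    show "(\<lambda>\<omega>. (rv_index \<omega>, rv_query C l \<omega>)) ` space \<Omega> \<subseteq> {1, 2} \<times> query_set C l"
      using measurable_space[OF measurable_query[OF l]]
      by (auto simp: rv_index_def rv_query_def space_ir_space)
    show "\<forall>z\<in>{1, 2} \<times> query_set C l - (\<lambda>\<omega>. (rv_index \<omega>, rv_query C l \<omega>)) ` space \<Omega>. ?t z = 0"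
    proof
      fix z assume z: "z \<in> {1, 2} \<times> query_set C l - (\<lambda>\<omega>. (rv_index \<omega>, rv_query C l \<omega>)) ` space \<Omega>"
      obtain x where x: "x \<in> T" using tuples_nonempty by auto
      have "query_event l (fst z) (snd z) = {}"
      proof (rule equals0I)
        fix s assume "s \<in> query_event l (fst z) (snd z)"
        then have "(fst z, s, x) \<in> space \<Omega>" "z = (\<lambda>\<omega>. (rv_index \<omega>, rv_query C l \<omega>)) (fst z, s, x)"
          using z x by (auto simp: space_ir_space query_event_def rv_index_def rv_query_def)
        with z show False by blast
      qed
      then show "?t z = 0" by (simp add: split_beta)
    qed
  qed
  also have "\<dots> = (\<Sum>m\<in>{1, 2}. \<Sum>q\<in>query_set C l. ?t (m, q))"
    by (simp add: sum.cartesian_product)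
  also have "\<dots> = (\<Sum>q\<in>query_set C l. ?t (1, q) + ?t (2, q))"
    by (simp add: sum.distrib)
  also have "\<dots> = (\<Sum>q\<in>query_set C l. mi_term (query_prob l 1 q) (query_prob l 2 q))"
    by (intro sum.cong) (simp_all add: mi_term_eq)
  finally show ?thesis .
qed

text \<open>The integrand is a finite combination of indicators of rectangles, exactly one of which
  contains a given outcome.\<close>

lemma expectation_of_queries:
  fixes g :: "nat \<Rightarrow> 'q \<Rightarrow> 'q \<Rightarrow> real"
  shows "expectation (\<lambda>\<omega>. g (rv_index \<omega>) (rv_query C 1 \<omega>) (rv_query C 2 \<omega>)) =
    (\<Sum>m\<in>{1, 2}. \<Sum>p\<in>query_set C 1. \<Sum>q\<in>query_set C 2. joint m p q * g m p q) / 2"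
proof -
  let ?R = "\<lambda>m p q. {m} \<times> joint_event m p q \<times> T"
  have sets: "?R m p q \<in> sets \<Omega>" if "m \<in> {1, 2}" for m p q
    using that by (intro sets_rectangle joint_event_sets) auto
  have rect: "prob (?R m p q) = joint m p q / 2" if "m \<in> {1, 2}" for m p q
    using prob_rectangle[OF that joint_event_sets[OF that] subset_refl] card_tuples_pos by simp
  have "g (rv_index \<omega>) (rv_query C 1 \<omega>) (rv_query C 2 \<omega>) =
      (\<Sum>m\<in>{1, 2}. \<Sum>p\<in>query_set C 1. \<Sum>q\<in>query_set C 2. g m p q * indicator (?R m p q) \<omega>)"
    if \<omega>: "\<omega> \<in> space \<Omega>" for \<omega>
  proof -
    obtain k s x where k: "\<omega> = (k, s, x)" "k \<in> {1, 2}" "s \<in> space (strategy C)" "x \<in> T"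
      using \<omega> by (auto simp: space_ir_space)
    let ?p = "query_fun C 1 k s" and ?q = "query_fun C 2 k s"
    have pq: "?p \<in> query_set C 1" "?q \<in> query_set C 2"
      using k measurable_space[OF measurable_query] by auto
    have "(\<Sum>q\<in>query_set C 2. g m p q * indicator (?R m p q) \<omega>) =
        (if m = k \<and> p = ?p then g k ?p ?q else 0)" for m p
    proof -
      have "(\<Sum>q\<in>query_set C 2. g m p q * indicator (?R m p q) \<omega>) =
        (\<Sum>q\<in>query_set C 2. if q = ?q then (if m = k \<and> p = ?p then g k ?p ?q else 0) else 0)"
        using k by (intro sum.cong) (auto simp: joint_event_def indicator_def)
      then show ?thesis using pq finite_query_set[of 2] by simp
    qed
    then have "(\<Sum>m\<in>{1, 2}. \<Sum>p\<in>query_set C 1. \<Sum>q\<in>query_set C 2. g m p q * indicator (?R m p q) \<omega>) =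
        (\<Sum>m\<in>{1, 2}. \<Sum>p\<in>query_set C 1. if p = ?p then (if m = k then g k ?p ?q else 0) else 0)"
      by (auto intro!: sum.cong)
    also have "\<dots> = (\<Sum>m\<in>{1, 2}. if m = k then g k ?p ?q else 0)"
      using pq finite_query_set[of 1] by (intro sum.cong) auto
    also have "\<dots> = g k ?p ?q" using k by auto
    finally show ?thesis by (simp add: k(1) rv_index_def rv_query_def)
  qed
  then have "expectation (\<lambda>\<omega>. g (rv_index \<omega>) (rv_query C 1 \<omega>) (rv_query C 2 \<omega>)) =
    expectation (\<lambda>\<omega>. \<Sum>m\<in>{1, 2}. \<Sum>p\<in>query_set C 1. \<Sum>q\<in>query_set C 2. g m p q * indicator (?R m p q) \<omega>)"
    by (intro Bochner_Integration.integral_cong) auto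
  also have "\<dots> = (\<Sum>m\<in>{1, 2}. \<Sum>p\<in>query_set C 1. \<Sum>q\<in>query_set C 2.
      expectation (\<lambda>\<omega>. g m p q * indicator (?R m p q) \<omega>))"
  proof -
    have int: "integrable \<Omega> (\<lambda>\<omega>. g m p q * indicator (?R m p q) \<omega>)" if "m \<in> {1, 2}" for m p q
      using sets[OF that] by (intro integrable_mult_right integrable_real_indicator) (auto simp: emeasure_eq_measure)
    show ?thesis
      using int by (subst Bochner_Integration.integral_sum, fastforce intro!: Bochner_Integration.integrable_sum,
        intro sum.cong refl)+
  qed
  also have "\<dots> = (\<Sum>m\<in>{1, 2}. \<Sum>p\<in>query_set C 1. \<Sum>q\<in>query_set C 2. joint m p q * g m p q / 2)"
    using sets by (intro sum.cong refl) (simp add: rect del: insert_iff)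
  finally show ?thesis by (simp only: sum_divide_distrib)
qed

lemma download_cost_eq:
  "download_cost 2 2 C =
    (\<Sum>m\<in>{1, 2}. \<Sum>p\<in>query_set C 1. \<Sum>q\<in>query_set C 2.
       joint m p q * (log 2 (card (ans_alphabet C)) * (ans_len C 1 p + ans_len C 2 q))) / 2"
proof -
  let ?c = "log 2 (card (ans_alphabet C))"
  have "(\<Sum>l = 1..2. expectation (\<lambda>\<omega>. real (ans_len C l (rv_query C l \<omega>)))) =
      (\<Sum>m\<in>{1, 2}. \<Sum>p\<in>query_set C 1. \<Sum>q\<in>query_set C 2. joint m p q * (ans_len C 1 p)) / 2 +
      (\<Sum>m\<in>{1, 2}. \<Sum>p\<in>query_set C 1. \<Sum>q\<in>query_set C 2. joint m p q * (ans_len C 2 q)) / 2"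
  proof -
    have "(\<Sum>l = 1..2. h l) = h 1 + h 2" for h :: "nat \<Rightarrow> real"
      by (simp add: atLeastAtMost_1_2[simplified])
    then show ?thesis
      using expectation_of_queries[of "\<lambda>m p q. real (ans_len C 1 p)"]
        expectation_of_queries[of "\<lambda>m p q. real (ans_len C 2 q)"]
      by (simp only:)
  qed
  also have "?c * \<dots> = (\<Sum>m\<in>{1, 2}. \<Sum>p\<in>query_set C 1. \<Sum>q\<in>query_set C 2.
      ?c * (joint m p q * (ans_len C 1 p) + joint m p q * (ans_len C 2 q))) / 2"
    by (simp only: sum.distrib sum_distrib_left distrib_left add_divide_distrib times_divide_eq_right)
  finally show ?thesis unfolding download_cost_def
    by (simp add: distrib_left mult_ac)
qed

lemma rv_observation_eq_iff:
  "rv_observation 2 C (k, t, y) = rv_observation 2 C (m, s, x) \<longleftrightarrow>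
     k = m \<and> query_fun C 1 k t = query_fun C 1 m s \<and> query_fun C 2 k t = query_fun C 2 m s \<and>
     ans_fun C 1 (query_fun C 1 m s) y = ans_fun C 1 (query_fun C 1 m s) x \<and>
     ans_fun C 2 (query_fun C 2 m s) y = ans_fun C 2 (query_fun C 2 m s) x"
proof -
  have eq: "restrict f {1..2} = restrict g {1..2} \<longleftrightarrow> f 1 = g 1 \<and> f 2 = g 2"
    for f g :: "nat \<Rightarrow> 'c"
    unfolding restrict_def fun_eq_iff atLeastAtMost_1_2 by auto
  have eq': "restrict f {1..2} = restrict g {1..2} \<longleftrightarrow> f 1 = g 1 \<and> f 2 = g 2"
    for f g :: "nat \<Rightarrow> 'd"
    unfolding restrict_def fun_eq_iff atLeastAtMost_1_2 by auto
  show ?thesis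
    unfolding rv_observation_def rv_query_def rv_answer_def rv_index_def prod.case prod.inject eq eq'
    by auto
qed

text \<open>Both probabilities in the entropy criterion carry the factor \<open>joint m p q\<close>.
  As the files are uniform, what remains is to compare the number of tuples giving the same answers
  with the number of those that also agree in file m. Query pairs of probability 0 are
  unconstrained.\<close>

lemma decodable_iff:
  "information_space.conditional_entropy_Pow \<Omega> 2 rv_requested_file (rv_observation 2 C) = 0 \<longleftrightarrow>
   (\<forall>m\<in>{1, 2}. \<forall>p q. joint m p q > 0 \<longrightarrow>
      (\<forall>x\<in>T. \<forall>y\<in>T. ans_fun C 1 p y = ans_fun C 1 p x \<longrightarrow> ans_fun C 2 q y = ans_fun C 2 q x \<longrightarrow> y m = x m))"
  (is "_ \<longleftrightarrow> ?R")
proof -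
  define F where "F p q x =
    {y \<in> T. ans_fun C 1 p y = ans_fun C 1 p x \<and> ans_fun C 2 q y = ans_fun C 2 q x}" for p q x
  let ?X = rv_requested_file and ?Y = "rv_observation 2 C"
  have "prob ((\<lambda>\<omega>. (?X \<omega>, ?Y \<omega>)) -` {(?X \<omega>, ?Y \<omega>)} \<inter> space \<Omega>) \<in> {0, prob (?Y -` {?Y \<omega>} \<inter> space \<Omega>)} \<longleftrightarrow>
      joint m p q = 0 \<or> (\<forall>y\<in>F p q x. y m = x m)"
    if \<omega>: "\<omega> = (m, s, x)" "m \<in> {1, 2}" "s \<in> space (strategy C)" "x \<in> T"
      and pq: "p = query_fun C 1 m s" "q = query_fun C 2 m s" for \<omega> m s x p q
  proof -
    let ?G = "{y \<in> F p q x. y m = x m}"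
    have FT: "F p q x \<subseteq> T" "?G \<subseteq> T" by (auto simp: F_def)
    have "?Y -` {?Y \<omega>} \<inter> space \<Omega> = {m} \<times> joint_event m p q \<times> F p q x"
      using \<omega> by (auto simp: rv_observation_eq_iff space_ir_space joint_event_def F_def pq)
    then have Y: "prob (?Y -` {?Y \<omega>} \<inter> space \<Omega>) = joint m p q * (card (F p q x) / card T) / 2"
      using \<omega> FT by (simp add: prob_rectangle joint_event_sets)
    have "(\<lambda>\<omega>. (?X \<omega>, ?Y \<omega>)) -` {(?X \<omega>, ?Y \<omega>)} \<inter> space \<Omega> = {m} \<times> joint_event m p q \<times> ?G"
      using \<omega> by (auto simp: rv_observation_eq_iff space_ir_space joint_event_def F_def pq rv_requested_file_def)
    then have XY: "prob ((\<lambda>\<omega>. (?X \<omega>, ?Y \<omega>)) -` {(?X \<omega>, ?Y \<omega>)} \<inter> space \<Omega>) =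
        joint m p q * (card ?G / card T) / 2"
      using \<omega> FT by (simp add: prob_rectangle joint_event_sets)
    have fin: "finite (F p q x)" using FT(1) finite_tuples by (rule finite_subset)
    \<comment> \<open>The outcome itself keeps \<open>?G\<close> nonempty, so probability 0 is
      possible only for a null query pair.\<close>
    have "x \<in> ?G" using \<omega> by (auto simp: F_def)
    then have "card ?G > 0" using fin by (auto simp: card_gt_0_iff)
    then have "joint m p q * (card ?G / card T) / 2 \<in> {0, joint m p q * (card (F p q x) / card T) / 2} \<longleftrightarrow>
        joint m p q = 0 \<or> card ?G = card (F p q x)"
      using card_tuples_pos by auto
    also have "card ?G = card (F p q x) \<longleftrightarrow> ?G = F p q x"
      using card_subset_eq[OF fin, of ?G] by auto
    also have "\<dots> \<longleftrightarrow> (\<forall>y\<in>F p q x. y m = x m)" by auto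
    finally show ?thesis unfolding XY Y .
  qed
  then have *: "information_space.conditional_entropy_Pow \<Omega> 2 ?X ?Y = 0 \<longleftrightarrow>
      (\<forall>m\<in>{1, 2}. \<forall>s\<in>space (strategy C). \<forall>x\<in>T.
         joint m (query_fun C 1 m s) (query_fun C 2 m s) = 0 \<or>
         (\<forall>y\<in>F (query_fun C 1 m s) (query_fun C 2 m s) x. y m = x m))"
    unfolding conditional_entropy_eq_0_iff_simple[OF simple_function_rv_requested_file simple_function_rv_observation]
    by (auto simp: space_ir_space simp del: insert_iff)
  have "joint m p q > 0 \<Longrightarrow> \<exists>s\<in>space (strategy C). query_fun C 1 m s = p \<and> query_fun C 2 m s = q" for m p q
  proof -
    assume "joint m p q > 0"
    then have "joint_event m p q \<noteq> {}" by force
    then show ?thesis by (auto simp: joint_event_def)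
  qed
  then show ?thesis unfolding * F_def
    by (smt (verit, best) measure_nonneg mem_Collect_eq)
qed

end

section \<open>The converse\<close>

lemma log_card_answers_le:
  assumes A: "finite A" "A \<noteq> {}" and T: "finite T" "T \<noteq> {}"
    and f: "\<And>x. x \<in> T \<Longrightarrow> set (f x) \<subseteq> A \<and> length (f x) = n"
    and g: "\<And>x. x \<in> T \<Longrightarrow> set (g x) \<subseteq> A \<and> length (g x) = k"
  shows "log 2 (card ((\<lambda>x. (f x, g x)) ` T)) \<le> log 2 (card A) * (real n + real k)"
proof -
  let ?B = "\<lambda>n. {w. set w \<subseteq> A \<and> length w = n}"
  have "card ((\<lambda>x. (f x, g x)) ` T) \<le> card (?B n \<times> ?B k)"
    using f g A by (intro card_mono image_subsetI) (simp_all add: finite_lists_length_eq)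
  also have "\<dots> = card A ^ (n + k)"
    using A by (simp add: card_cartesian_product card_lists_length_eq power_add)
  finally have le: "real (card ((\<lambda>x. (f x, g x)) ` T)) \<le> real (card A) ^ (n + k)"
    by (simp flip: of_nat_power)
  have "card ((\<lambda>x. (f x, g x)) ` T) > 0" using T by (simp add: card_gt_0_iff)
  then have "log 2 (card ((\<lambda>x. (f x, g x)) ` T)) \<le> log 2 (real (card A) ^ (n + k))"
    using le A by (subst log_le_cancel_iff) auto
  then show ?thesis by (simp add: log_nat_power mult.commute)
qed

lemma two_server_schemeI:
  assumes "is_ir_scheme 2 2 C" "finite (query_set C 1)" "finite (query_set C 2)"
  shows "two_server_scheme C"
  using assms unfolding two_server_scheme_def is_ir_scheme_def by auto

context two_server_scheme
begin

text \<open>Positive probability of the query pair makes its answers determine file m, as the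
  counting lemmas require. The answer lengths are fixed by the queries, which bounds the number of
  answer pairs by a power of the alphabet size.\<close>

lemma
  assumes scheme: "is_ir_scheme 2 2 C"
    and pq: "m \<in> {1, 2}" "p \<in> query_set C 1" "q \<in> query_set C 2" "joint m p q > 0"
  defines "L \<equiv> log 2 (card words)"
    and "d \<equiv> log 2 (card (ans_alphabet C)) * (real (ans_len C 1 p) + real (ans_len C 2 q))"
  shows download_ge_1: "L + interference words T m (ans_fun C 1 p) \<le> d"
    and download_ge_2: "L + interference words T m (ans_fun C 2 q) \<le> d"
    and interference_sum_ge:
      "L \<le> interference words T (3 - m) (ans_fun C 1 p) + interference words T (3 - m) (ans_fun C 2 q)"
proof -
  have dec: "x m = y m" if "x \<in> T" "y \<in> T"
    "ans_fun C 1 p x = ans_fun C 1 p y" "ans_fun C 2 q x = ans_fun C 2 q y" for x y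
    using scheme[unfolded is_ir_scheme_def] decodable_iff pq that by blast
  have A: "finite (ans_alphabet C)" "ans_alphabet C \<noteq> {}"
    using scheme by (auto simp: is_ir_scheme_def)
  have ans: "set (ans_fun C 1 p x) \<subseteq> ans_alphabet C \<and> length (ans_fun C 1 p x) = ans_len C 1 p"
    "set (ans_fun C 2 q x) \<subseteq> ans_alphabet C \<and> length (ans_fun C 2 q x) = ans_len C 2 q"
    if "x \<in> T" for x
    using scheme pq that by (auto simp: is_ir_scheme_def)
  note B = card_answers_ge[OF finite_words words_nonempty, folded file_tuples_def]
  have "L + interference words T m (ans_fun C 1 p) \<le>
      log 2 (card ((\<lambda>x. (ans_fun C 1 p x, ans_fun C 2 q x)) ` T))"
    unfolding L_def using pq(1) dec by (intro B) auto
  also have "\<dots> \<le> d"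
    unfolding d_def using A finite_tuples tuples_nonempty ans by (rule log_card_answers_le)
  finally show "L + interference words T m (ans_fun C 1 p) \<le> d" .
  have "L + interference words T m (ans_fun C 2 q) \<le>
      log 2 (card ((\<lambda>x. (ans_fun C 2 q x, ans_fun C 1 p x)) ` T))"
    unfolding L_def using pq(1) dec by (intro B) auto
  also have "\<dots> \<le> log 2 (card (ans_alphabet C)) * (real (ans_len C 2 q) + real (ans_len C 1 p))"
    using A finite_tuples tuples_nonempty ans(2,1) by (rule log_card_answers_le)
  finally show "L + interference words T m (ans_fun C 2 q) \<le> d"
    by (simp add: d_def add.commute)
  show "L \<le> interference words T (3 - m) (ans_fun C 1 p) + interference words T (3 - m) (ans_fun C 2 q)"
    unfolding L_def file_tuples_def using pq(1) dec
    by (intro interference_add_ge[OF finite_words words_nonempty]) (auto simp: file_tuples_def)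
qed

lemma noleak_query_prob:
  assumes "l \<in> {1, 2}" "index_query_MI 2 C l = 0" "q \<in> query_set C l"
  shows "query_prob l 1 q = query_prob l 2 q"
proof -
  have "mi_term (query_prob l 1 q) (query_prob l 2 q) = 0"
    using assms finite_query_set[OF assms(1)] index_query_MI_eq[OF assms(1)]
    by (simp add: sum_nonneg_eq_0_iff mi_term_nonneg)
  then show ?thesis by (simp add: mi_term_eq_0_iff)
qed

text \<open>\<open>sum_download_ge\<close> takes the first query to be the nonleaking one. If server
  2 is nonleaking, it is applied to the joint law with its two query arguments interchanged, and the
  order of summation is swapped back.\<close>

lemma download_cost_ge:
  assumes scheme: "is_ir_scheme 2 2 C"
    and l: "(l, k) \<in> {(1, 2), (2, 1)}" and noleak: "index_query_MI 2 C l = 0"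
  shows "log 2 (card words) *
      (1 + (\<Sum>q\<in>query_set C k. min (query_prob k 1 q) (query_prob k 2 q)) / 2) \<le> download_cost 2 2 C"
proof -
  let ?A = "query_set C 1" and ?B = "query_set C 2"
  let ?r = "\<lambda>l m p. interference words T m (ans_fun C l p)"
  let ?d = "\<lambda>p q. log 2 (card (ans_alphabet C)) * (real (ans_len C 1 p) + real (ans_len C 2 q))"
  have r0: "?r l m p \<ge> 0" if "m \<in> {1, 2}" for l m p
    unfolding file_tuples_def using that by (rule interference_nonneg[OF finite_words words_nonempty])
  have fin: "finite ?A" "finite ?B" using finite_query_set by auto
  from l consider "l = 1" "k = 2" | "l = 2" "k = 1" by auto
  then show ?thesis
  proof cases
    case 1
    have "log 2 (card words) *
        (1 + (\<Sum>q\<in>?B. min (\<Sum>p\<in>?A. joint 1 p q) (\<Sum>p\<in>?A. joint 2 p q)) / 2) \<le>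
        (\<Sum>m\<in>{1, 2}. \<Sum>p\<in>?A. \<Sum>q\<in>?B. joint m p q * ?d p q) / 2"
    proof (rule sum_download_ge[where J = joint and r = "?r 1" and s = "?r 2"])
      show "(\<Sum>q\<in>?B. joint 1 p q) = (\<Sum>q\<in>?B. joint 2 p q)" if "p \<in> ?A" for p
        using noleak_query_prob[OF _ noleak, of p] that 1
          query_prob_1_eq_sum_joint[of 1 p] query_prob_1_eq_sum_joint[of 2 p] by simp
    qed (use fin sum_joint r0 download_ge_1[OF scheme] download_ge_2[OF scheme]
        interference_sum_ge[OF scheme] in simp_all)
    then show ?thesis using 1 by (simp add: download_cost_eq query_prob_2_eq_sum_joint)
  next
    case 2
    have "log 2 (card words) *
        (1 + (\<Sum>p\<in>?A. min (\<Sum>q\<in>?B. joint 1 p q) (\<Sum>q\<in>?B. joint 2 p q)) / 2) \<le>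
        (\<Sum>m\<in>{1, 2}. \<Sum>q\<in>?B. \<Sum>p\<in>?A. joint m p q * ?d p q) / 2"
    proof (rule sum_download_ge[where J = "\<lambda>m q p. joint m p q" and r = "?r 2" and s = "?r 1"])
      show "(\<Sum>p\<in>?A. joint 1 p q) = (\<Sum>p\<in>?A. joint 2 p q)" if "q \<in> ?B" for q
        using noleak_query_prob[OF _ noleak, of q] that 2
          query_prob_2_eq_sum_joint[of 1 q] query_prob_2_eq_sum_joint[of 2 q] by simp
      show "(\<Sum>q\<in>?B. \<Sum>p\<in>?A. joint m p q) = 1" if "m \<in> {1, 2}" for m
        using sum_joint[OF that] by (subst sum.swap)
    qed (use fin r0 download_ge_1[OF scheme] download_ge_2[OF scheme]
        interference_sum_ge[OF scheme] in \<open>simp_all add: add.commute\<close>)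
    also have "\<dots> = (\<Sum>m\<in>{1, 2}. \<Sum>p\<in>?A. \<Sum>q\<in>?B. joint m p q * ?d p q) / 2"
      by (subst sum.swap[of _ ?A]) (rule refl)
    finally show ?thesis using 2 query_prob_1_eq_sum_joint[of 1] query_prob_1_eq_sum_joint[of 2]
      by (simp add: download_cost_eq)
  qed
qed

text \<open>Half the overlap of the two laws of the leaking query is at least the inverse entropy
  value. A file has a positive number of bits, so the download cost is positive and the bound passes
  to the quotient.\<close>

lemma ir_rate_le:
  assumes scheme: "is_ir_scheme 2 2 C" and \<rho>: "0 \<le> \<rho>" "\<rho> \<le> 1 / 2"
    and leak: "MI_leakage 2 2 C \<le> \<rho>" and noleak: "\<exists>l\<in>{1, 2}. index_query_MI 2 C l = 0"
  shows "ir_rate 2 2 C \<le> inverse (1 + binary_entropy_inv (1 - 2 * \<rho>))"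
proof -
  obtain l k :: nat where l: "(l, k) \<in> {(1, 2), (2, 1)}" and MI: "index_query_MI 2 C l = 0"
    using noleak by auto
  have k: "k \<in> {1, 2}" using l by auto
  let ?e = "binary_entropy_inv (1 - 2 * \<rho>)" and ?L = "log 2 (card words)"
  have "(\<Sum>l = 1..2. index_query_MI 2 C l) = index_query_MI 2 C l + index_query_MI 2 C k"
    using l by (auto simp: atLeastAtMost_1_2[simplified])
  then have "index_query_MI 2 C k \<le> 2 * \<rho>"
    using leak MI by (simp add: MI_leakage_def)
  then have "?e \<le> (\<Sum>q\<in>query_set C k. min (query_prob k 1 q) (query_prob k 2 q)) / 2"
    using finite_query_set[OF k] sum_query_prob[OF k] \<rho> index_query_MI_eq[OF k]
    by (intro sum_min_ge_binary_entropy_inv) auto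
  moreover have L: "?L = file_len C * log 2 (card (file_alphabet C))"
    by (simp add: card_words log_nat_power)
  moreover have "?L > 0"
    unfolding L using scheme by (auto simp: is_ir_scheme_def intro!: mult_pos_pos)
  ultimately have "?L * (1 + ?e) \<le> download_cost 2 2 C"
    using download_cost_ge[OF scheme l MI]
    by (elim order_trans[rotated]) (auto intro!: mult_left_mono)
  moreover have "1 + ?e > 0" using binary_entropy_inv(1)[of "1 - 2 * \<rho>"] \<rho> by auto
  ultimately have "?L / download_cost 2 2 C \<le> ?L / (?L * (1 + ?e))"
    using \<open>?L > 0\<close> by (intro divide_left_mono) (auto intro!: mult_pos_pos elim: order.strict_trans2[rotated])
  also have "\<dots> = inverse (1 + ?e)" using \<open>?L > 0\<close> by (simp add: inverse_eq_divide)
  finally show ?thesis by (simp add: ir_rate_def L)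
qed

end

section \<open>The optimal scheme\<close>

text \<open>Files are single bits and the strategy is 1 with probability \<open>e\<close>. Query 0
  silences server 1 and query 1 asks it for the sum, so its query equals its answer length; query q
  asks server 2 for file q. Server 2 sees the index through a binary symmetric channel with
  crossover probability \<open>e\<close>, while the query to server 1 does not depend on the
  index.\<close>

definition opt_scheme :: "real \<Rightarrow> (nat, nat, nat, nat) ir_scheme" where
  "opt_scheme e = \<lparr>
     file_alphabet = {0, 1}, file_len = 1, ans_alphabet = {0, 1},
     strategy = measure_pmf (map_pmf of_bool (bernoulli_pmf e)),
     query_set = (\<lambda>l. if l = 1 then {0, 1} else {1, 2}),
     query_fun = (\<lambda>l m s. if l = 1 then of_bool (s \<noteq> 0) else if s = 0 then m else 3 - m),
     ans_len = (\<lambda>l q. if l = 1 then q else 1),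
     ans_fun = (\<lambda>l q x. if l = 1 then (if q = 0 then [] else [(hd (x 1) + hd (x 2)) mod 2]) else x q)\<rparr>"

context
  fixes e :: real
  assumes e: "e \<in> {0..1/2}"
begin

lemma two_server_scheme_opt: "two_server_scheme (opt_scheme e)"
  unfolding two_server_scheme_def by (auto simp: opt_scheme_def measure_pmf.prob_space_axioms)

interpretation O: two_server_scheme "opt_scheme e"
  by (rule two_server_scheme_opt)

lemma opt_tuple_cases:
  assumes "x \<in> O.T" "i \<in> {1, 2}"
  shows "x i = [0] \<or> x i = [1]"
proof -
  have "x i \<in> O.words" using assms by (auto simp: file_tuples_def)
  then show ?thesis by (auto simp: opt_scheme_def length_Suc_conv)
qed

lemma prob_opt_strategy: "O.S.prob {s. s = 0} = 1 - e" "O.S.prob {s. s \<noteq> 0} = e"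
proof -
  have "(of_bool :: bool \<Rightarrow> nat) -` {s. s = 0} = {False}" "(of_bool :: bool \<Rightarrow> nat) -` {s. s \<noteq> 0} = {True}"
    by (auto simp: of_bool_def)
  then show "O.S.prob {s. s = 0} = 1 - e" "O.S.prob {s. s \<noteq> 0} = e"
    using e by (simp_all only: opt_scheme_def ir_scheme.select_convs measure_map_pmf)
      (simp_all add: measure_pmf_single)
qed

lemma opt_query_prob:
  "O.query_prob 1 m 0 = 1 - e" "O.query_prob 1 m 1 = e"
  "m \<in> {1, 2} \<Longrightarrow> q \<in> {1, 2} \<Longrightarrow> O.query_prob 2 m q = (if q = m then 1 - e else e)"
proof -
  have [simp]: "space (strategy (opt_scheme e)) = UNIV" by (simp add: opt_scheme_def)
  have "O.query_event 1 m 0 = {s. s = 0}" "O.query_event 1 m 1 = {s. s \<noteq> 0}"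
    unfolding O.query_event_def by (auto simp: opt_scheme_def of_bool_def)
  then show "O.query_prob 1 m 0 = 1 - e" "O.query_prob 1 m 1 = e"
    by (simp_all only: prob_opt_strategy)
  assume "m \<in> {1, 2}" "q \<in> {1, 2}"
  then have "O.query_event 2 m q = (if q = m then {s. s = 0} else {s. s \<noteq> 0})"
    unfolding O.query_event_def by (auto simp: opt_scheme_def)
  then show "O.query_prob 2 m q = (if q = m then 1 - e else e)"
    by (metis prob_opt_strategy)
qed

lemma index_query_MI_opt:
  "index_query_MI 2 (opt_scheme e) 1 = 0"
  "index_query_MI 2 (opt_scheme e) 2 = 1 - binary_entropy e"
proof -
  have Q: "query_set (opt_scheme e) 1 = {0, 1}" "query_set (opt_scheme e) 2 = {1, 2}"
    by (simp_all add: opt_scheme_def)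
  have same: "mi_term a a = 0" if "a \<ge> 0" for a using that by (simp add: mi_term_eq_0_iff)
  have "index_query_MI 2 (opt_scheme e) 1 = mi_term (1 - e) (1 - e) + mi_term e e"
    by (subst O.index_query_MI_eq) (simp_all add: Q[simplified] opt_query_prob[simplified])
  then show "index_query_MI 2 (opt_scheme e) 1 = 0" using e by (simp add: same)
  have "index_query_MI 2 (opt_scheme e) 2 = mi_term (1 - e) e + mi_term e (1 - e)"
    by (subst O.index_query_MI_eq) (simp_all add: Q opt_query_prob(3)[simplified])
  also have "\<dots> = 1 - binary_entropy e"
  proof -
    have "min e (1 - e) = e" "min (1 - e) e = e" using e by auto
    then show ?thesis by (simp add: mi_term_def)
  qed
  finally show "index_query_MI 2 (opt_scheme e) 2 = 1 - binary_entropy e" .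
qed

lemma download_cost_opt: "download_cost 2 2 (opt_scheme e) = 1 + e"
proof -
  let ?Q = "query_set (opt_scheme e)"
  have Q: "?Q 1 = {0, 1}" by (simp add: opt_scheme_def)
  have len: "ans_len (opt_scheme e) 1 p = p" "ans_len (opt_scheme e) 2 q = 1" for p q
    by (simp_all add: opt_scheme_def)
  have "download_cost 2 2 (opt_scheme e) =
      (\<Sum>m\<in>{1, 2}. \<Sum>p\<in>?Q 1. \<Sum>q\<in>?Q 2. O.joint m p q * (real p + 1)) / 2"
    unfolding O.download_cost_eq len by (simp add: opt_scheme_def)
  \<comment> \<open>Server 2 always sends one bit, so only the law of the query to server 1
    matters.\<close>
  also have "\<dots> = (\<Sum>m\<in>{1, 2}. \<Sum>p\<in>?Q 1. O.query_prob 1 m p * (real p + 1)) / 2"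
    by (intro arg_cong2[of _ _ _ _ "(/)"] sum.cong refl) (simp only: O.query_prob_1_eq_sum_joint sum_distrib_right)
  also have "\<dots> = 1 + e"
    unfolding Q by (simp add: opt_query_prob[simplified] field_simps)
  finally show ?thesis .
qed

lemma opt_scheme_sel:
  "query_fun (opt_scheme e) 1 m s = of_bool (s \<noteq> 0)"
  "query_fun (opt_scheme e) 2 m s = (if s = 0 then m else 3 - m)"
  "ans_fun (opt_scheme e) 1 q x = (if q = 0 then [] else [(hd (x 1) + hd (x 2)) mod 2])"
  "ans_fun (opt_scheme e) 2 q x = x q"
  by (simp_all add: opt_scheme_def)

lemma is_ir_scheme_opt: "is_ir_scheme 2 2 (opt_scheme e)"
  unfolding is_ir_scheme_def atLeastAtMost_1_2
proof (intro conjI ballI)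
  have dec: "y m = x m" if m: "m \<in> {1, 2}" and J: "O.joint m p q > 0" and xy: "x \<in> O.T" "y \<in> O.T"
    and ans: "ans_fun (opt_scheme e) 1 p y = ans_fun (opt_scheme e) 1 p x"
      "ans_fun (opt_scheme e) 2 q y = ans_fun (opt_scheme e) 2 q x" for m p q x y
  proof -
    have "O.joint_event m p q \<noteq> {}" using J by force
    then obtain s where "s \<in> O.joint_event m p q" by blast
    then have s: "p = of_bool (s \<noteq> 0)" "q = (if s = 0 then m else 3 - m)"
      unfolding O.joint_event_def opt_scheme_sel by blast+
    show ?thesis
    proof (cases "s = 0")
      case True
      then show ?thesis using ans(2) s(2) unfolding opt_scheme_sel by simp
    next
      \<comment> \<open>Server 2 returns the unwanted bit, which cancels from the parity returned by
        server 1.\<close>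
      case False
      have parity: "(hd (y 1) + hd (y 2)) mod 2 = (hd (x 1) + hd (x 2)) mod 2"
        using ans(1) s(1) False unfolding opt_scheme_sel by simp
      have other: "y (3 - m) = x (3 - m)"
        using ans(2) s(2) False unfolding opt_scheme_sel by simp
      have "hd (z 1) + hd (z 2) = hd (z m) + hd (z (3 - m))" for z :: "nat \<Rightarrow> nat list"
        using m by auto
      with parity other have "(hd (y m) + hd (x (3 - m))) mod 2 = (hd (x m) + hd (x (3 - m))) mod 2"
        by simp
      then have "hd (y m) mod 2 = hd (x m) mod 2" by presburger
      then show ?thesis
        using opt_tuple_cases[OF xy(1) m] opt_tuple_cases[OF xy(2) m] by auto
    qed
  qed
  show "information_space.conditional_entropy_Pow O.\<Omega> 2 rv_requested_file (rv_observation 2 (opt_scheme e)) = 0"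
    unfolding O.decodable_iff by (intro ballI allI impI) (rule dec)
next
  fix l q x assume l: "l \<in> {1, 2::nat}" and q: "q \<in> query_set (opt_scheme e) l" and x: "x \<in> O.T"
  have "set (ans_fun (opt_scheme e) l q x) \<subseteq> {0, 1} \<and>
      length (ans_fun (opt_scheme e) l q x) = ans_len (opt_scheme e) l q"
  proof (cases "l = 1")
    case True
    with q show ?thesis by (auto simp: opt_scheme_def)
  next
    case False
    with l q have "l = 2" "q \<in> {1, 2}" by (auto simp: opt_scheme_def)
    then show ?thesis using opt_tuple_cases[OF x, of q] by (auto simp: opt_scheme_def)
  qed
  then show "set (ans_fun (opt_scheme e) l q x) \<subseteq> ans_alphabet (opt_scheme e)"
    and "length (ans_fun (opt_scheme e) l q x) = ans_len (opt_scheme e) l q"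
    by (simp_all add: opt_scheme_def)
next
  show "prob_space (strategy (opt_scheme e))" by (rule O.prob_space_strategy)
  show "query_fun (opt_scheme e) l m \<in> strategy (opt_scheme e) \<rightarrow>\<^sub>M count_space (query_set (opt_scheme e) l)"
    if "l \<in> {1, 2}" "m \<in> {1, 2}" for l m
    using that by (rule O.measurable_query)
qed (simp_all add: opt_scheme_def)

text \<open>Server 1 has three raw answers: \<open>[]\<close>, \<open>[0]\<close> and
  \<open>[1]\<close>. Identifying the empty answer with another value leaves two, as many as a
  one-bit file has values.\<close>

lemma answer_values_opt:
  assumes l: "l \<in> {1, 2}"
  shows "finite (answer_values 2 (opt_scheme e) l) \<and> card (answer_values 2 (opt_scheme e) l) \<le> 2"
proof -
  let ?V = "rv_answer (opt_scheme e) l ` space O.\<Omega>"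
  have "rv_answer (opt_scheme e) l (m, s, x) \<in> {[], [0], [1]}" if "m \<in> {1, 2}" "x \<in> O.T" for m s x
    using l that(1) opt_tuple_cases[OF that(2), of m] opt_tuple_cases[OF that(2), of "3 - m"]
    unfolding rv_answer_def prod.case
    by (cases "s = 0") (auto simp: opt_scheme_sel opt_scheme_sel[simplified])
  then have "?V \<subseteq> {[], [0], [1]}" by (auto simp: O.space_ir_space)
  then have "answer_values 2 (opt_scheme e) l \<subseteq> {[0], [1]} \<or> answer_values 2 (opt_scheme e) l = {[]}"
    by (auto simp: answer_values_def Let_def)
  then show ?thesis
  proof
    assume *: "answer_values 2 (opt_scheme e) l \<subseteq> {[0], [1]}"
    then show ?thesis using card_mono[OF _ *] finite_subset[OF *] by simp
  qed simp
qed

end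

theorem theorem9:
  fixes \<rho> :: real
  assumes "0 \<le> \<rho>" and "\<rho> \<le> 1 / 2"
  shows "(\<exists>C :: (nat, nat, nat, nat) ir_scheme.
            admissible \<rho> C \<and> ir_rate 2 2 C = inverse (1 + binary_entropy_inv (1 - 2 * \<rho>))) \<and>
         (\<forall>C :: ('s, 'x, 'a, 'q) ir_scheme.
            admissible \<rho> C \<longrightarrow> ir_rate 2 2 C \<le> inverse (1 + binary_entropy_inv (1 - 2 * \<rho>)))"
proof (intro conjI allI impI)
  fix C :: "('s, 'x, 'a, 'q) ir_scheme"
  assume C: "admissible \<rho> C"
  then interpret two_server_scheme C
    by (intro two_server_schemeI) (auto simp: admissible_def)
  show "ir_rate 2 2 C \<le> inverse (1 + binary_entropy_inv (1 - 2 * \<rho>))"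
    using C assms by (intro ir_rate_le) (auto simp: admissible_def)
next
  \<comment> \<open>With this choice the leaking server has mutual information 1 - H_b(e) = 2\<rho>,
    and averaging with the nonleaking one gives exactly \<rho>.\<close>
  define e where "e = binary_entropy_inv (1 - 2 * \<rho>)"
  have e: "e \<in> {0..1/2}" "binary_entropy e = 1 - 2 * \<rho>"
    using assms binary_entropy_inv[of "1 - 2 * \<rho>"] by (auto simp: e_def)
  let ?C = "opt_scheme e"
  have "MI_leakage 2 2 ?C = \<rho>"
    using index_query_MI_opt[OF e(1)] e(2)
    by (simp add: MI_leakage_def atLeastAtMost_1_2[simplified])
  moreover have "\<exists>\<alpha>::nat. \<forall>l\<in>{1, 2}. finite (query_set ?C l) \<and> card (query_set ?C l) \<le> \<alpha> \<and>
      finite (answer_values 2 ?C l) \<and>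
      card (answer_values 2 ?C l) \<le> card (file_alphabet ?C) ^ file_len ?C"
  proof -
    have Q: "query_set ?C l = (if l = 1 then {0, 1} else {1, 2})" for l
      by (simp add: opt_scheme_def)
    have "card (file_alphabet ?C) ^ file_len ?C = 2"
      by (simp add: opt_scheme_def)
    then show ?thesis
      using answer_values_opt[OF e(1)] by (intro exI[of _ 2]) (auto simp: Q)
  qed
  ultimately have "admissible \<rho> ?C"
    using is_ir_scheme_opt[OF e(1)] index_query_MI_opt(1)[OF e(1)] by (auto simp: admissible_def)
  moreover have "ir_rate 2 2 ?C = inverse (1 + e)"
    unfolding ir_rate_def download_cost_opt[OF e(1)] by (simp add: opt_scheme_def field_simps)
  ultimately show "\<exists>C :: (nat, nat, nat, nat) ir_scheme.
      admissible \<rho> C \<and> ir_rate 2 2 C = inverse (1 + binary_entropy_inv (1 - 2 * \<rho>))"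
    unfolding e_def by blast
qed

end
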